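(* For every integer $n \ge 3$ and every $0 < C < \frac{n-1}{n}$, the $n$-manifold $\mathbb{R}^2 \times \mathbb{T}^{n-2}$ admits a complete Riemannian metric of positive scalar curvature with at most $C$-quadratic decay at infinity.
   Context: $\mathbb{T}^{k}$ denotes the $k$-dimensional torus. Quadratic decay: Let $M$ be a complete (connected) Riemannian manifold with scalar curvature $R$, fix a basepoint $x\in M$ and let $r_x(y)=d(x,y)$. The scalar curvature has at most $C$-quadratic decay at infinity if there exists a constant $D_0>0$ such that $R(y) > C/r_x(y)^2$ for every $y\in M$ with $r_x(y)\ge D_0$. For conditions of the form "for every $0<C<C_0$" the choice of basepoint is immaterial. *)

theory Defs
  imports "HOL-Analysis.Analysis"
begin

section \<open>Smooth maps on open subsets of Euclidean space\<close>

primrec times_differentiable_on ::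
    "nat \<Rightarrow> ('a::real_normed_vector \<Rightarrow> 'b::real_normed_vector) \<Rightarrow> 'a set \<Rightarrow> bool" where
  "times_differentiable_on 0 f S \<longleftrightarrow> continuous_on S f"
| "times_differentiable_on (Suc k) f S \<longleftrightarrow>
     (\<forall>x\<in>S. f differentiable (at x)) \<and>
     (\<forall>v. times_differentiable_on k (\<lambda>x. frechet_derivative f (at x) v) S)"

text \<open>Only meaningful for open \<open>S\<close>, since derivatives are taken in the ambient space.\<close>

definition smooth_on ::
    "('a::real_normed_vector \<Rightarrow> 'b::real_normed_vector) \<Rightarrow> 'a set \<Rightarrow> bool" where
  "smooth_on f S \<longleftrightarrow> (\<forall>k. times_differentiable_on k f S)"


section \<open>Smooth manifolds\<close>

text \<open>
  A chart is a pair \<open>(U, \<phi>)\<close>; the values of \<open>\<phi>\<close> outside \<open>U\<close> carry no information. A manifold is a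
  subset \<open>M\<close> of an ambient topological type, with the subspace topology, together with an atlas.
\<close>

type_synonym ('a, 'm) chart = "'a set \<times> ('a \<Rightarrow> real^'m)"

definition chart_image :: "('a, 'm) chart \<Rightarrow> (real^'m) set" where
  "chart_image c = snd c ` fst c"

definition transition :: "('a, 'm) chart \<Rightarrow> ('a, 'm) chart \<Rightarrow> real^'m \<Rightarrow> real^'m" where
  "transition c c' = snd c' \<circ> inv_into (fst c) (snd c)"

definition smooth_atlas ::
    "'a::{t2_space,second_countable_topology} set \<Rightarrow> ('a, 'm::finite) chart set \<Rightarrow> bool" where
  "smooth_atlas M A \<longleftrightarrow>
     (\<Union>c\<in>A. fst c) = M \<and>
     (\<forall>c\<in>A. openin (top_of_set M) (fst c) \<and> open (chart_image c) \<and>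
        (\<exists>h. homeomorphism (fst c) (chart_image c) (snd c) h)) \<and>
     (\<forall>c\<in>A. \<forall>c'\<in>A. smooth_on (transition c c') (snd c ` (fst c \<inter> fst c')))"

definition chart_at :: "('a, 'm) chart set \<Rightarrow> 'a \<Rightarrow> ('a, 'm) chart" where
  "chart_at A p = (SOME c. c \<in> A \<and> p \<in> fst c)"


section \<open>Riemannian metrics\<close>

text \<open>
  A Riemannian metric is given by its local components: \<open>g c x $ i $ j\<close> is the component
  $g_{ij}$ in the chart \<open>c\<close> at the coordinate point \<open>x\<close>. The last condition is the transformation
  rule of a tensor of type $(0,2)$.
\<close>

type_synonym ('a, 'm) metric_components = "('a, 'm) chart \<Rightarrow> real^'m \<Rightarrow> real^'m^'m"

definition riemannian_metric ::
    "('a, 'm::finite) chart set \<Rightarrow> ('a, 'm) metric_components \<Rightarrow> bool" where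
  "riemannian_metric A g \<longleftrightarrow>
     (\<forall>c\<in>A.
        (\<forall>i j. smooth_on (\<lambda>x. g c x $ i $ j) (chart_image c)) \<and>
        (\<forall>x\<in>chart_image c.
           transpose (g c x) = g c x \<and> (\<forall>v. v \<noteq> 0 \<longrightarrow> 0 < v \<bullet> (g c x *v v)))) \<and>
     (\<forall>c\<in>A. \<forall>c'\<in>A. \<forall>x\<in>snd c ` (fst c \<inter> fst c').
        let J = jacobian (transition c c') (at x) in
        g c x = transpose J ** g c' (transition c c' x) ** J)"


subsection \<open>Scalar curvature\<close>

definition partial :: "'m \<Rightarrow> (real^'m::finite \<Rightarrow> real) \<Rightarrow> real^'m \<Rightarrow> real" where
  "partial i f x = frechet_derivative f (at x) (axis i 1)"

text \<open>\<open>christoffel G k i j\<close> is $\Gamma^k_{ij}$.\<close>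

definition christoffel ::
    "(real^'m \<Rightarrow> real^'m^'m) \<Rightarrow> 'm::finite \<Rightarrow> 'm \<Rightarrow> 'm \<Rightarrow> real^'m \<Rightarrow> real" where
  "christoffel G k i j x =
     (\<Sum>l\<in>UNIV. matrix_inv (G x) $ k $ l *
        (partial i (\<lambda>y. G y $ j $ l) x + partial j (\<lambda>y. G y $ i $ l) x
          - partial l (\<lambda>y. G y $ i $ j) x)) / 2"

text \<open>
  \<open>riemann G l k i j\<close> is the component along $\partial_l$ of $R(\partial_i,\partial_j)\partial_k$, where
  $R(X,Y)Z = \nabla_X\nabla_Y Z - \nabla_Y\nabla_X Z - \nabla_{[X,Y]}Z$. With the contraction below,
  the unit sphere of dimension $m$ has scalar curvature $m(m-1)$.
\<close>

definition riemann ::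
    "(real^'m \<Rightarrow> real^'m^'m) \<Rightarrow> 'm::finite \<Rightarrow> 'm \<Rightarrow> 'm \<Rightarrow> 'm \<Rightarrow> real^'m \<Rightarrow> real" where
  "riemann G l k i j x =
     partial i (christoffel G l j k) x - partial j (christoffel G l i k) x
     + (\<Sum>m\<in>UNIV. christoffel G l i m x * christoffel G m j k x
                  - christoffel G l j m x * christoffel G m i k x)"

definition ricci :: "(real^'m \<Rightarrow> real^'m^'m) \<Rightarrow> 'm::finite \<Rightarrow> 'm \<Rightarrow> real^'m \<Rightarrow> real" where
  "ricci G j k x = (\<Sum>i\<in>UNIV. riemann G i k i j x)"

definition coord_scalar_curvature :: "(real^'m \<Rightarrow> real^'m^'m) \<Rightarrow> real^'m::finite \<Rightarrow> real" where
  "coord_scalar_curvature G x =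
     (\<Sum>j\<in>UNIV. \<Sum>k\<in>UNIV. matrix_inv (G x) $ j $ k * ricci G j k x)"

definition scalar_curvature ::
    "('a, 'm::finite) chart set \<Rightarrow> ('a, 'm) metric_components \<Rightarrow> 'a \<Rightarrow> real" where
  "scalar_curvature A g p =
     (let c = chart_at A p in coord_scalar_curvature (g c) (snd c p))"


subsection \<open>Riemannian distance and completeness\<close>

definition C1_curve_on ::
    "('a, 'm::finite) chart set \<Rightarrow> (real \<Rightarrow> 'a) \<Rightarrow> real \<Rightarrow> real \<Rightarrow> bool" where
  "C1_curve_on A \<gamma> a b \<longleftrightarrow>
     (\<forall>c\<in>A. let T = {t \<in> {a..b}. \<gamma> t \<in> fst c} in
        \<exists>v. continuous_on T v \<and>
            (\<forall>t\<in>T. (snd c \<circ> \<gamma> has_vector_derivative v t) (at t within {a..b})))"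

text \<open>
  The finite set \<open>S\<close> holds the break points; the curve has to be $C^1$ on each closed interval
  between two consecutive ones.
\<close>

definition piecewise_C1_path ::
    "'a::topological_space set \<Rightarrow> ('a, 'm::finite) chart set \<Rightarrow> (real \<Rightarrow> 'a) \<Rightarrow> bool" where
  "piecewise_C1_path M A \<gamma> \<longleftrightarrow>
     path \<gamma> \<and> path_image \<gamma> \<subseteq> M \<and>
     (\<exists>S. finite S \<and> {0, 1} \<subseteq> S \<and> S \<subseteq> {0..1} \<and>
        (\<forall>a\<in>S. \<forall>b\<in>S. a < b \<and> {a<..<b} \<inter> S = {} \<longrightarrow> C1_curve_on A \<gamma> a b))"

text \<open>
  The value of \<open>speed\<close> is arbitrary at the (finitely many) break points, which does not affect
  the length.
\<close>

definition speed ::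
    "('a, 'm::finite) chart set \<Rightarrow> ('a, 'm) metric_components \<Rightarrow> (real \<Rightarrow> 'a) \<Rightarrow> real \<Rightarrow> real" where
  "speed A g \<gamma> t =
     (let c = chart_at A (\<gamma> t); v = vector_derivative (snd c \<circ> \<gamma>) (at t)
      in sqrt (v \<bullet> (g c (snd c (\<gamma> t)) *v v)))"

definition curve_length ::
    "('a, 'm::finite) chart set \<Rightarrow> ('a, 'm) metric_components \<Rightarrow> (real \<Rightarrow> 'a) \<Rightarrow> real" where
  "curve_length A g \<gamma> = integral {0..1} (speed A g \<gamma>)"

text \<open>
  For connected \<open>M\<close>. The value outside \<open>M\<close> is set to \<open>0\<close> because the library's
  \<open>Metric_space M d\<close> requires \<open>d\<close> to be symmetric and nonnegative on the whole type.
\<close>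

definition riemannian_dist ::
    "'a::topological_space set \<Rightarrow> ('a, 'm::finite) chart set \<Rightarrow> ('a, 'm) metric_components
       \<Rightarrow> 'a \<Rightarrow> 'a \<Rightarrow> real" where
  "riemannian_dist M A g p q =
     (if p \<in> M \<and> q \<in> M
      then Inf {curve_length A g \<gamma> | \<gamma>.
                  piecewise_C1_path M A \<gamma> \<and> pathstart \<gamma> = p \<and> pathfinish \<gamma> = q}
      else 0)"

definition complete_metric ::
    "'a::topological_space set \<Rightarrow> ('a, 'm::finite) chart set \<Rightarrow> ('a, 'm) metric_components \<Rightarrow> bool" where
  "complete_metric M A g \<longleftrightarrow> Metric_space.mcomplete M (riemannian_dist M A g)"


subsection \<open>Positive scalar curvature and its decay at infinity\<close>

definition positive_scalar_curvature ::
    "'a set \<Rightarrow> ('a, 'm::finite) chart set \<Rightarrow> ('a, 'm) metric_components \<Rightarrow> bool" where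
  "positive_scalar_curvature M A g \<longleftrightarrow> (\<forall>p\<in>M. 0 < scalar_curvature A g p)"

definition at_most_quadratic_decay ::
    "real \<Rightarrow> 'a::topological_space set \<Rightarrow> ('a, 'm::finite) chart set \<Rightarrow> ('a, 'm) metric_components
       \<Rightarrow> 'a \<Rightarrow> bool" where
  "at_most_quadratic_decay C M A g x \<longleftrightarrow>
     (\<exists>D\<^sub>0>0. \<forall>y\<in>M. riemannian_dist M A g x y \<ge> D\<^sub>0 \<longrightarrow>
        scalar_curvature A g y > C / (riemannian_dist M A g x y)\<^sup>2)"


section \<open>The product of the plane with a torus\<close>

text \<open>
  The torus is the product of \<open>CARD('k)\<close> copies of the unit circle in the complex plane. The
  charts are the inverses of the covering map restricted to boxes on which all angles range
  over an open interval of length \<open>2 * pi\<close>.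
\<close>

definition plane_times_torus :: "((real^2) \<times> (complex^('k::finite))) set" where
  "plane_times_torus = UNIV \<times> {z. \<forall>j. z $ j \<in> sphere 0 1}"

definition plane_torus_covering :: "real^(2 + 'k::finite) \<Rightarrow> (real^2) \<times> (complex^'k)" where
  "plane_torus_covering x = ((\<chi> i. x $ Inl i), (\<chi> j. cis (x $ Inr j)))"

definition angle_box :: "real^'k \<Rightarrow> (real^(2 + 'k::finite)) set" where
  "angle_box a = {x. \<forall>j. a $ j < x $ Inr j \<and> x $ Inr j < a $ j + 2 * pi}"

definition plane_torus_chart :: "real^'k::finite \<Rightarrow> ((real^2) \<times> (complex^'k), 2 + 'k) chart" where
  "plane_torus_chart a =
     (plane_torus_covering ` angle_box a, inv_into (angle_box a) plane_torus_covering)"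

definition plane_torus_atlas :: "((real^2) \<times> (complex^('k::finite)), 2 + 'k) chart set" where
  "plane_torus_atlas = range plane_torus_chart"


subsection \<open>The charts form a smooth atlas\<close>

lemma times_differentiable_on_cong:
  assumes "open S" "\<And>x. x \<in> S \<Longrightarrow> f x = g x" "times_differentiable_on k f S"
  shows "times_differentiable_on k g S"
  using assms(2,3)
proof (induction k arbitrary: f g)
  case 0
  then show ?case by (simp cong: continuous_on_cong)
next
  case (Suc k)
  have d: "(g has_derivative F) (at x)" if "x \<in> S" "(f has_derivative F) (at x)" for x F
    using has_derivative_transform_within_open[OF that(2) \<open>open S\<close> that(1)] Suc.prems(1) by blast
  have e: "frechet_derivative g (at x) = frechet_derivative f (at x)" if "x \<in> S" for x
    using that Suc.prems(2) d frechet_derivative_at frechet_derivative_works by (metis times_differentiable_on.simps(2))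
  have "g differentiable (at x)" if "x \<in> S" for x
    using that Suc.prems(2) d by (metis times_differentiable_on.simps(2) differentiable_def)
  moreover have "times_differentiable_on k (\<lambda>x. frechet_derivative g (at x) v) S" for v
  proof (rule Suc.IH)
    show "times_differentiable_on k (\<lambda>x. frechet_derivative f (at x) v) S"
      using Suc.prems(2) by simp
  qed (simp only: e)
  ultimately show ?case by auto
qed

lemma times_differentiable_on_const: "times_differentiable_on k (\<lambda>x. c) S"
  by (induction k arbitrary: c) auto

lemma smooth_on_locally_translation:
  assumes "open S"
    and "\<And>x. x \<in> S \<Longrightarrow> \<exists>d T. open T \<and> x \<in> T \<and> (\<forall>y\<in>T. f y = y + d)"
  shows "smooth_on f S"
  unfolding smooth_on_def
proof
  fix k
  have D: "(f has_derivative (\<lambda>v. v)) (at x)" if "x \<in> S" for x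
  proof -
    obtain d T where T: "open T" "x \<in> T" "\<forall>y\<in>T. f y = y + d"
      using assms(2)[OF \<open>x \<in> S\<close>] by blast
    have "((\<lambda>y. y + d) has_derivative (\<lambda>v. v)) (at x)"
      by (auto intro!: derivative_eq_intros)
    then show ?thesis
      using has_derivative_transform_within_open[OF _ T(1,2)] T(3) by metis
  qed
  have F: "frechet_derivative f (at x) v = v" if "x \<in> S" for x v
    using frechet_derivative_at[OF D[OF that]] by metis
  show "times_differentiable_on k f S"
  proof (cases k)
    case 0
    then show ?thesis
      using D by (auto intro!: continuous_at_imp_continuous_on has_derivative_continuous)
  next
    case (Suc m)
    have "times_differentiable_on m (\<lambda>x. frechet_derivative f (at x) v) S" for v
      by (rule times_differentiable_on_cong[OF \<open>open S\<close> _ times_differentiable_on_const[of m v]])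
        (simp add: F)
    then show ?thesis
      using Suc D by (auto simp: differentiable_def)
  qed
qed

lemma angle_box_open: "open (angle_box a)"
proof -
  have "angle_box a = (\<Inter>j. {x. a $ j < x $ Inr j} \<inter> {x. x $ Inr j < a $ j + 2 * pi})"
    by (auto simp: angle_box_def)
  moreover have "open \<dots>"
    by (intro open_INT open_Int finite ballI open_Collect_less continuous_intros)
  ultimately show ?thesis by simp
qed

lemma plane_torus_covering_in: "plane_torus_covering x \<in> plane_times_torus"
  by (simp add: plane_torus_covering_def plane_times_torus_def)

lemma plane_torus_covering_eq_iff:
  "plane_torus_covering x = plane_torus_covering y \<longleftrightarrow>
     (\<forall>i. x $ Inl i = y $ Inl i) \<and> (\<forall>j. cis (x $ Inr j) = cis (y $ Inr j))"
  by (auto simp: plane_torus_covering_def vec_eq_iff)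

lemma continuous_plane_torus_covering: "continuous_on S plane_torus_covering"
  unfolding plane_torus_covering_def by (intro continuous_intros)

lemma cis_eq_near:
  assumes "cis x = cis y" "\<bar>x - y\<bar> < 2 * pi"
  shows "x = y"
proof -
  have "cis (x - y) = 1"
    using assms(1) by (simp flip: cis_divide)
  then have "cos (x - y) = 1"
    by (simp add: complex_eq_iff)
  then obtain n :: int where n: "x - y = n * 2 * pi"
    using cos_one_2pi_int by auto
  then have "\<bar>real_of_int n\<bar> * (2 * pi) < 1 * (2 * pi)"
    using assms(2) by (simp add: abs_mult mult.assoc)
  then have "\<bar>real_of_int n\<bar> < 1"
    using pi_gt_zero by (subst (asm) mult_less_cancel_right_pos) auto
  then have "n = 0" by linarith
  with n show ?thesis by simp
qed

lemma inj_on_angle_box: "inj_on plane_torus_covering (angle_box a)"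
proof (rule inj_onI)
  fix x y :: "real^(2 + 'a)"
  assume *: "x \<in> angle_box a" "y \<in> angle_box a"
    "plane_torus_covering x = plane_torus_covering y"
  have "x $ i = y $ i" for i
  proof (cases i)
    case (Inl i')
    then show ?thesis using * by (simp add: plane_torus_covering_eq_iff)
  next
    case (Inr j)
    have "a $ j < x $ Inr j \<and> x $ Inr j < a $ j + 2 * pi"
      "a $ j < y $ Inr j \<and> y $ Inr j < a $ j + 2 * pi"
      using * by (auto simp: angle_box_def)
    then have "\<bar>x $ Inr j - y $ Inr j\<bar> < 2 * pi" by linarith
    then show ?thesis
      using * Inr cis_eq_near by (simp add: plane_torus_covering_eq_iff)
  qed
  then show "x = y" by (simp add: vec_eq_iff)
qed

lemma plane_torus_covering_open_map:
  assumes "open W"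
  shows "openin (top_of_set plane_times_torus) (plane_torus_covering ` W)"
  unfolding openin_subopen[of _ "plane_torus_covering ` W"]
proof
  fix p assume "p \<in> plane_torus_covering ` W"
  then obtain x where x: "x \<in> W" "p = plane_torus_covering x" by blast
  define s :: "(real^2) \<times> (complex^'a) \<Rightarrow> real^(2 + 'a)" where
    "s q = (\<chi> i. case i of Inl l \<Rightarrow> fst q $ l
             | Inr j \<Rightarrow> x $ Inr j + Arg (snd q $ j / cis (x $ Inr j)))" for q
  have sp: "s p = x"
    by (auto simp: s_def x(2) plane_torus_covering_def vec_eq_iff split: sum.split)
  have ps: "plane_torus_covering (s q) = q" if "q \<in> plane_times_torus" for q
  proof -
    have "cis (x $ Inr j + Arg (snd q $ j / cis (x $ Inr j))) = snd q $ j" for j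
    proof -
      have n: "norm (snd q $ j) = 1"
        using that by (auto simp: plane_times_torus_def)
      then have "cis (Arg (snd q $ j / cis (x $ Inr j))) = snd q $ j / cis (x $ Inr j)"
        by (subst cis_Arg) (auto simp: sgn_div_norm norm_divide)
      then show ?thesis by (simp flip: cis_mult)
    qed
    then show ?thesis
      by (auto simp: plane_torus_covering_def s_def vec_eq_iff prod_eq_iff)
  qed
  have "continuous (at p) (\<lambda>q. s q $ i)" for i
  proof (cases i)
    case (Inl l)
    then show ?thesis by (simp add: s_def continuous_intros)
  next
    case (Inr j)
    have "continuous (at p) (\<lambda>q. snd q $ j / cis (x $ Inr j))"
      by (intro continuous_intros) auto
    moreover have "continuous (at (snd p $ j / cis (x $ Inr j))) Arg"
      by (rule continuous_at_Arg) (simp add: x(2) plane_torus_covering_def)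
    ultimately have "continuous (at p) (\<lambda>q. Arg (snd q $ j / cis (x $ Inr j)))"
      using continuous_within_compose3[where f = "\<lambda>q. snd q $ j / cis (x $ Inr j)" and g = Arg]
      by blast
    with Inr show ?thesis by (simp add: s_def continuous_intros)
  qed
  then have "continuous (at p) (\<lambda>q. \<chi> i. s q $ i)"
    unfolding continuous_def by (intro tendsto_vec_lambda) auto
  then have "continuous (at p) s" by simp
  then obtain T where T: "open T" "p \<in> T" "\<forall>q\<in>T. s q \<in> W"
    using \<open>open W\<close> x(1) sp unfolding continuous_at_open by metis
  have "T \<inter> plane_times_torus \<subseteq> plane_torus_covering ` W"
    using T(3) ps by (metis Int_iff image_eqI subsetI)
  moreover have "openin (top_of_set plane_times_torus) (T \<inter> plane_times_torus)"
    using T(1) by (metis inf_commute openin_open_Int)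
  moreover have "p \<in> T \<inter> plane_times_torus"
    using T(2) x(2) plane_torus_covering_in by auto
  ultimately show "\<exists>T. openin (top_of_set plane_times_torus) T \<and> p \<in> T \<and>
      T \<subseteq> plane_torus_covering ` W"
    by blast
qed

lemma fst_plane_torus_chart: "fst (plane_torus_chart a) = plane_torus_covering ` angle_box a"
  and snd_plane_torus_chart: "snd (plane_torus_chart a) = inv_into (angle_box a) plane_torus_covering"
  by (simp_all add: plane_torus_chart_def)

lemma chart_image_plane_torus_chart: "chart_image (plane_torus_chart a) = angle_box a"
  by (auto simp: chart_image_def plane_torus_chart_def inv_into_image_cancel
      inj_on_angle_box image_iff inv_into_f_f)

lemma plane_torus_chart_homeomorphism:
  "homeomorphism (plane_torus_covering ` angle_box a) (angle_box a)
     (inv_into (angle_box a) plane_torus_covering) plane_torus_covering"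
proof -
  have "openin (top_of_set (plane_torus_covering ` angle_box a)) (plane_torus_covering ` U)"
    if "openin (top_of_set (angle_box a)) U" for U
  proof -
    have "open U" "U \<subseteq> angle_box a"
      using that angle_box_open openin_open_trans openin_imp_subset by blast+
    then show ?thesis
      using openin_subset_trans[OF plane_torus_covering_open_map[of U],
          of "plane_torus_covering ` angle_box a"] plane_torus_covering_in
      by blast
  qed
  then have "continuous_on (plane_torus_covering ` angle_box a)
      (inv_into (angle_box a) plane_torus_covering)"
    by (intro continuous_on_inverse_open_map[OF continuous_plane_torus_covering refl])
      (auto simp: inj_on_angle_box)
  then show ?thesis
    using continuous_plane_torus_covering
    by (auto simp: homeomorphism_def inj_on_angle_box image_iff inv_into_f_f)
qed

lemma transition_plane_torus_chart:
  fixes a b :: "real^'k::finite"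
  assumes "x \<in> angle_box a" "plane_torus_covering x \<in> plane_torus_covering ` angle_box b"
  obtains d T where "open T" "x \<in> T" "T \<subseteq> angle_box a"
    "plane_torus_covering ` T \<subseteq> plane_torus_covering ` angle_box b"
    "\<And>y. y \<in> T \<Longrightarrow> transition (plane_torus_chart a) (plane_torus_chart b) y = y + d"
proof -
  obtain z where z: "z \<in> angle_box b" "plane_torus_covering x = plane_torus_covering z"
    using assms(2) by blast
  define T where "T = angle_box a \<inter> (\<lambda>y. y + (z - x)) -` angle_box b"
  have "open T"
    unfolding T_def
    by (intro open_Int angle_box_open open_vimage continuous_intros)
  have eq: "plane_torus_covering (y + (z - x)) = plane_torus_covering y" for y
  proof -
    have "cis (z $ Inr j - x $ Inr j) = 1" for j
      using z(2) by (simp add: plane_torus_covering_eq_iff flip: cis_divide)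
    moreover have "z $ Inl i = x $ Inl i" for i
      using z(2) by (simp add: plane_torus_covering_eq_iff)
    ultimately show ?thesis
      by (simp add: plane_torus_covering_eq_iff flip: cis_mult)
  qed
  have inv: "inv_into (plane_torus_covering ` angle_box a)
      (inv_into (angle_box a) plane_torus_covering) y = plane_torus_covering y"
    if "y \<in> angle_box a" for y
    by (rule inv_into_f_eq)
      (use that in \<open>auto intro!: inj_on_inv_into simp: inj_on_angle_box inv_into_f_f\<close>)
  have "transition (plane_torus_chart a) (plane_torus_chart b) y = y + (z - x)"
    if "y \<in> T" for y
  proof -
    have "inv_into (angle_box b) plane_torus_covering (plane_torus_covering y) = y + (z - x)"
      using that eq by (intro inv_into_f_eq inj_on_angle_box) (auto simp: T_def)
    then show ?thesis
      using that inv by (simp add: transition_def plane_torus_chart_def T_def)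
  qed
  moreover have "plane_torus_covering ` T \<subseteq> plane_torus_covering ` angle_box b"
  proof
    fix q assume "q \<in> plane_torus_covering ` T"
    then obtain y where "y \<in> T" "q = plane_torus_covering (y + (z - x))"
      using eq by auto
    then show "q \<in> plane_torus_covering ` angle_box b"
      by (auto simp: T_def)
  qed
  ultimately show ?thesis
    using that[of T "z - x"] \<open>open T\<close> assms(1) z(1) by (auto simp: T_def)
qed

lemma smooth_atlas_plane_torus_atlas:
  "smooth_atlas plane_times_torus (plane_torus_atlas :: ((real^2) \<times> (complex^('k::finite)), 2 + 'k) chart set)"
proof -
  let ?M = "plane_times_torus :: ((real^2) \<times> (complex^'k)) set"
  let ?P = "plane_torus_covering :: _ \<Rightarrow> (real^2) \<times> (complex^'k)"
  have "p \<in> (\<Union>c\<in>plane_torus_atlas. fst c)" if "p \<in> ?M" for p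
  proof -
    define x :: "real^(2 + 'k)" where
      "x = (\<chi> i. case i of Inl l \<Rightarrow> fst p $ l | Inr j \<Rightarrow> Arg (snd p $ j))"
    have "norm (snd p $ j) = 1" for j
      using that by (auto simp: plane_times_torus_def)
    then have "snd p $ j \<noteq> 0 \<and> sgn (snd p $ j) = snd p $ j" for j
      by (metis norm_zero zero_neq_one sgn_div_norm inverse_1 scaleR_one)
    then have "?P x = p"
      by (auto simp: plane_torus_covering_def x_def vec_eq_iff prod_eq_iff cis_Arg)
    moreover have "x \<in> angle_box (\<chi> j. x $ Inr j - pi)"
      by (simp add: angle_box_def)
    ultimately show ?thesis
      unfolding plane_torus_atlas_def by (force simp: fst_plane_torus_chart)
  qed
  moreover have "(\<Union>c\<in>plane_torus_atlas. fst c) \<subseteq> ?M"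
    by (auto simp: plane_torus_atlas_def fst_plane_torus_chart plane_torus_covering_in)
  moreover have "smooth_on (transition (plane_torus_chart a) (plane_torus_chart b))
      (snd (plane_torus_chart a) ` (fst (plane_torus_chart a) \<inter> fst (plane_torus_chart b)))"
    for a b :: "real^'k"
  proof -
    let ?S = "angle_box a \<inter> {x. ?P x \<in> ?P ` angle_box b}"
    have S: "snd (plane_torus_chart a) ` (fst (plane_torus_chart a) \<inter> fst (plane_torus_chart b)) = ?S"
    proof (intro set_eqI iffI)
      fix x assume "x \<in> snd (plane_torus_chart a) ` (fst (plane_torus_chart a) \<inter> fst (plane_torus_chart b))"
      then obtain q where q: "x = inv_into (angle_box a) ?P q"
        "q \<in> ?P ` angle_box a" "q \<in> ?P ` angle_box b"
        unfolding fst_plane_torus_chart snd_plane_torus_chart by blast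
      then have "x \<in> angle_box a" "?P x = q"
        using inv_into_into f_inv_into_f by metis+
      with q(3) show "x \<in> ?S" by simp
    next
      fix x assume "x \<in> ?S"
      then show "x \<in> snd (plane_torus_chart a) ` (fst (plane_torus_chart a) \<inter> fst (plane_torus_chart b))"
        by (intro image_eqI[of _ _ "?P x"])
          (auto simp: plane_torus_chart_def inj_on_angle_box inv_into_f_f)
    qed
    have "\<exists>T. open T \<and> x \<in> T \<and> T \<subseteq> ?S" if "x \<in> ?S" for x
    proof -
      from that have "x \<in> angle_box a" "?P x \<in> ?P ` angle_box b" by auto
      then obtain T where "open T" "x \<in> T" "T \<subseteq> angle_box a" "?P ` T \<subseteq> ?P ` angle_box b"
        by (rule transition_plane_torus_chart) blast
      then show ?thesis by (intro exI[of _ T]) auto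
    qed
    then have "open ?S"
      using openI by (metis (no_types, lifting) open_subopen)
    then show ?thesis
      unfolding S
    proof (rule smooth_on_locally_translation)
      fix x assume "x \<in> ?S"
      then have "x \<in> angle_box a" "?P x \<in> ?P ` angle_box b" by auto
      then obtain d T where "open T" "x \<in> T"
        "\<And>y. y \<in> T \<Longrightarrow> transition (plane_torus_chart a) (plane_torus_chart b) y = y + d"
        by (rule transition_plane_torus_chart) blast
      then show "\<exists>d T. open T \<and> x \<in> T \<and>
          (\<forall>y\<in>T. transition (plane_torus_chart a) (plane_torus_chart b) y = y + d)"
        by blast
    qed
  qed
  moreover have "openin (top_of_set ?M) (fst (plane_torus_chart a)) \<and>
      open (chart_image (plane_torus_chart a)) \<and>
      (\<exists>h. homeomorphism (fst (plane_torus_chart a)) (chart_image (plane_torus_chart a))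
         (snd (plane_torus_chart a)) h)" for a :: "real^'k"
    unfolding fst_plane_torus_chart snd_plane_torus_chart chart_image_plane_torus_chart
    using plane_torus_covering_open_map[OF angle_box_open] angle_box_open
      plane_torus_chart_homeomorphism by blast
  ultimately show ?thesis
    unfolding smooth_atlas_def by (auto simp: plane_torus_atlas_def)
qed

end

theory Submission
  imports Defs
begin

text \<open>
  With $\alpha = 1/(n-1)$, $S = 1 + |x|^2$ and $\ell = 2 + \frac12 \ln S$, take the metric
  $e^{2u}|dx|^2 + e^{2v}\sum_j d\varphi_j^2$ where $v = \alpha\ln\ell$ and $u = v - \frac12\ln S$. In
  the distance $r$ to the core it is asymptotic to $dr^2 + r^{2/n}(d\theta^2 + \sum_j d\varphi_j^2)$;
  the exponent $1/n$ maximises the limit of $r^2 R$ among powers, with value $(n-1)/n$. For this choice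
  $R > (1+\alpha)\,\ell^{-2-2\alpha} = \frac{n-1}{n} F^{-2}$ on the whole manifold, where
  $F = \ell^{1+\alpha}/(1+\alpha)$ is 1-Lipschitz. Hence $d(x,y) \ge F(y) - F(x)$, which gives the decay.

  The maps $F$, $x \mapsto x/(2\sqrt S)$ and the projection to the torus are all 1-Lipschitz, and
  together they determine the point continuously. So a Cauchy sequence converges in the ambient space,
  and straight segments in the universal cover bound the distance to its limit.
\<close>

section \<open>Scalar curvature of diagonal metrics\<close>

text \<open>The metric is \<ell>^(2\<alpha>) times the product of Hamilton's cigar |dx|^2/S and a
  flat torus. The cigar is a smooth cap whose end is asymptotic to a flat cylinder with axial
  coordinate ln |x|, and \<ell> is a smooth stand-in for 2 + ln |x|. Radial arc length is
  asymptotically the integral of \<ell>^\<alpha> in \<ell>, which is F. Functions of |x|^2 in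
  Cartesian coordinates avoid the polar singularity at the origin; the price is a Hessian
  computation in two plane variables instead of a warped product in one.

  The curvature bound must hold at the core as well as at infinity. There the cigar's own curvature
  4/S pays for it, and the summand 2 in \<ell> keeps that contribution dominant.

  Distance is an infimum over curves described in charts. No geodesic is computed: every lower bound
  comes from differentiating a function on the ambient space R^2 x C^k along a curve. The components
  depend on x alone and transitions are locally translations, so one matrix function serves in every
  chart.\<close>

lemma partial_has_derivative:
  assumes "(f has_derivative F) (at x)"
  shows "partial i f x = F (axis i 1)"
  using frechet_derivative_at[OF assms] by (simp add: partial_def)

text \<open>Scales are stored as logarithms: invertibility then needs no hypothesis, and the
  Christoffel symbols are linear in the first derivatives of \<open>w\<close>.\<close>

definition diagonal_metric :: "('m \<Rightarrow> real^'m \<Rightarrow> real) \<Rightarrow> real^'m \<Rightarrow> real^'m^'m::finite" where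
  "diagonal_metric w x = (\<chi> i j. if i = j then exp (2 * w i x) else 0)"

lemma matrix_inv_diagonal_metric:
  "matrix_inv (diagonal_metric w x) = (\<chi> i j. if i = j then exp (- 2 * w i x) else 0)" (is "_ = ?B")
proof -
  have "diagonal_metric w x ** ?B = mat 1" "?B ** diagonal_metric w x = mat 1"
    by (auto simp: diagonal_metric_def matrix_matrix_mult_def mat_def vec_eq_iff
        if_distrib[where f = "\<lambda>a. a * _"] simp flip: exp_add cong: if_cong)
  then show ?thesis
    unfolding matrix_inv_def
  \<comment> \<open>\<open>matrix_inv\<close> is a choice, so the candidate must be shown to be the
    only two-sided inverse.\<close>
  proof (intro some_equality)
    fix C assume C: "diagonal_metric w x ** C = mat 1 \<and> C ** diagonal_metric w x = mat 1"
    then have "C = C ** (diagonal_metric w x ** ?B)"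
      using \<open>diagonal_metric w x ** ?B = mat 1\<close> by simp
    also have "\<dots> = ?B"
      using C by (simp only: matrix_mul_assoc matrix_mul_lid)
    finally show "C = ?B" .
  qed simp
qed

lemma partial_diagonal_metric:
  assumes "\<And>i y. w i differentiable (at y)"
  shows "partial i (\<lambda>y. diagonal_metric w y $ j $ l) x =
    (if j = l then 2 * exp (2 * w j x) * partial i (w j) x else 0)"
proof (cases "j = l")
  case True
  have "(w j has_derivative frechet_derivative (w j) (at x)) (at x)"
    using assms frechet_derivative_works by blast
  then have "((\<lambda>y. exp (2 * w j y)) has_derivative
      (\<lambda>h. 2 * exp (2 * w j x) * frechet_derivative (w j) (at x) h)) (at x)"
    by (auto intro!: derivative_eq_intros)
  from partial_has_derivative[OF this] True show ?thesis
    by (simp add: diagonal_metric_def partial_def)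
next
  case False
  then show ?thesis
    using partial_has_derivative[OF has_derivative_const[of 0]] by (simp add: diagonal_metric_def)
qed

lemma christoffel_diagonal_metric:
  assumes "\<And>i y. w i differentiable (at y)"
  shows "christoffel (diagonal_metric w) k i j x =
    (if j = k then partial i (w k) x else 0) + (if i = k then partial j (w k) x else 0)
    - (if i = j then exp (2 * (w i x - w k x)) * partial k (w i) x else 0)"
proof -
  have sum_delta_mult: "(\<Sum>l\<in>UNIV. (if k = l then a l else 0) * b l) = a k * b k" for a b :: "'a \<Rightarrow> real"
    by (simp add: if_distrib[where f = "\<lambda>c. c * _"] cong: if_cong)
  have e: "exp (- (2 * w k x)) * exp (2 * w l x) = exp (2 * (w l x - w k x))" for l
    by (simp flip: exp_add)
  have "christoffel (diagonal_metric w) k i j x = exp (- 2 * w k x) *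
      ((if j = k then 2 * exp (2 * w j x) * partial i (w j) x else 0)
      + (if i = k then 2 * exp (2 * w i x) * partial j (w i) x else 0)
      - (if i = j then 2 * exp (2 * w i x) * partial k (w i) x else 0)) / 2"
    unfolding christoffel_def partial_diagonal_metric[OF assms] matrix_inv_diagonal_metric
    by (simp only: vec_lambda_beta sum_delta_mult)
  also have "\<dots> = (if j = k then (exp (- (2 * w k x)) * exp (2 * w j x)) * partial i (w k) x else 0)
      + (if i = k then (exp (- (2 * w k x)) * exp (2 * w i x)) * partial j (w k) x else 0)
      - (if i = j then (exp (- (2 * w k x)) * exp (2 * w i x)) * partial k (w i) x else 0)"
    by (auto simp: algebra_simps)
  finally show ?thesis
    unfolding e by simp
qed

text \<open>This is the sectional curvature of the (i,j) coordinate plane. The last sum runs over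
  all \<open>m\<close>; its terms \<open>m = i\<close> and \<open>m = j\<close> are compensated by
  the factor 2 on the mixed products, where the formula with \<open>m\<close> distinct from
  \<open>i\<close> and \<open>j\<close> has factor 1.\<close>

lemma riemann_diagonal_metric:
  assumes w: "\<And>i y. w i differentiable (at y)"
    and w': "\<And>i m y. partial m (w i) differentiable (at y)"
    and "i \<noteq> j"
  shows "exp (- 2 * w j x) * riemann (diagonal_metric w) i j i j x =
    - exp (- 2 * w i x) * (partial i (partial i (w j)) x + (partial i (w j) x)\<^sup>2
        - 2 * partial i (w i) x * partial i (w j) x)
    - exp (- 2 * w j x) * (partial j (partial j (w i)) x + (partial j (w i) x)\<^sup>2
        - 2 * partial j (w i) x * partial j (w j) x)
    - (\<Sum>m\<in>UNIV. exp (- 2 * w m x) * partial m (w i) x * partial m (w j) x)"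
proof -
  let ?G = "diagonal_metric w" and ?d = "\<lambda>m i. partial m (w i) x"
  note C = christoffel_diagonal_metric[of w, OF w]
  have f: "(f has_derivative frechet_derivative f (at x)) (at x)"
    if "f differentiable (at x)" for f :: "real^'a \<Rightarrow> real"
    using that frechet_derivative_works by blast
  have C1: "christoffel ?G i j j = (\<lambda>y. - (exp (2 * (w j y - w i y)) * partial i (w j) y))"
    and C2: "christoffel ?G i i j = partial j (w i)"
    using \<open>i \<noteq> j\<close> by (auto simp: C)
  have "((\<lambda>y. - (exp (2 * (w j y - w i y)) * partial i (w j) y)) has_derivative
     (\<lambda>h. - exp (2 * (w j x - w i x)) *
        (frechet_derivative (partial i (w j)) (at x) h + partial i (w j) x *
        2 * (frechet_derivative (w j) (at x) h - frechet_derivative (w i) (at x) h)))) (at x)"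
    by (rule derivative_eq_intros f w w' refl | simp add: algebra_simps)+
  from partial_has_derivative[OF this]
  have P1: "partial i (christoffel ?G i j j) x =
     - exp (2 * (w j x - w i x)) * (partial i (partial i (w j)) x + 2 * ?d i j * (?d i j - ?d i i))"
    unfolding C1 by (simp add: partial_def algebra_simps)
  have S1: "(\<Sum>m\<in>UNIV. christoffel ?G i i m x * christoffel ?G m j j x) =
     2 * ?d j i * ?d j j - (\<Sum>m\<in>UNIV. exp (2 * (w j x - w m x)) * ?d m i * ?d m j)"
  proof -
    have "christoffel ?G i i m x * christoffel ?G m j j x =
      (if m = j then 2 * ?d j i * ?d j j else 0) - exp (2 * (w j x - w m x)) * ?d m i * ?d m j" for m
      by (auto simp: C algebra_simps)
    then show ?thesis
      by (simp add: sum_subtractf)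
  qed
  have S2: "(\<Sum>m\<in>UNIV. christoffel ?G i j m x * christoffel ?G m i j x) =
     (?d j i)\<^sup>2 - exp (2 * (w j x - w i x)) * (?d i j)\<^sup>2"
  proof -
    have "christoffel ?G i j m x * christoffel ?G m i j x =
      (if m = i then (?d j i)\<^sup>2 else 0) - (if m = j then exp (2 * (w j x - w i x)) * (?d i j)\<^sup>2 else 0)" for m
      using \<open>i \<noteq> j\<close> by (auto simp: C power2_eq_square)
    then show ?thesis
      by (simp add: sum_subtractf)
  qed
  have e: "exp (- 2 * w j x) * exp (2 * (w j x - w m x)) = exp (- 2 * w m x)" for m
    by (simp flip: exp_add)
  have e': "exp (- 2 * w j x) * (\<Sum>m\<in>UNIV. exp (2 * (w j x - w m x)) * ?d m i * ?d m j)
      = (\<Sum>m\<in>UNIV. exp (- 2 * w m x) * ?d m i * ?d m j)"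
    by (simp only: sum_distrib_left mult.assoc[symmetric] e)
  define X where "X = (\<Sum>m\<in>UNIV. exp (2 * (w j x - w m x)) * ?d m i * ?d m j)"
  have "riemann ?G i j i j x =
     - exp (2 * (w j x - w i x)) * (partial i (partial i (w j)) x + (?d i j)\<^sup>2 - 2 * ?d i i * ?d i j)
     - (partial j (partial j (w i)) x + (?d j i)\<^sup>2 - 2 * ?d j i * ?d j j) - X"
    unfolding riemann_def P1 sum_subtractf S1 S2 C2 X_def by (simp add: algebra_simps power2_eq_square)
  then have "exp (- 2 * w j x) * riemann ?G i j i j x =
     - (exp (- 2 * w j x) * exp (2 * (w j x - w i x))) * (partial i (partial i (w j)) x + (?d i j)\<^sup>2 - 2 * ?d i i * ?d i j)
     - exp (- 2 * w j x) * (partial j (partial j (w i)) x + (?d j i)\<^sup>2 - 2 * ?d j i * ?d j j)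
     - exp (- 2 * w j x) * X"
    by (simp only:) (simp add: algebra_simps)
  then show ?thesis
    unfolding e unfolding X_def e' by simp
qed

text \<open>A diagonal inverse leaves only the Ricci terms with equal indices, so the trace is the
  sum of sectional curvatures of coordinate planes over ordered pairs.\<close>

lemma scalar_curvature_diagonal_metric:
  assumes w: "\<And>i y. w i differentiable (at y)"
    and w': "\<And>i m y. partial m (w i) differentiable (at y)"
  shows "coord_scalar_curvature (diagonal_metric w) x = (\<Sum>j\<in>UNIV. \<Sum>i\<in>UNIV. if i = j then 0 else
    - exp (- 2 * w i x) * (partial i (partial i (w j)) x + (partial i (w j) x)\<^sup>2
        - 2 * partial i (w i) x * partial i (w j) x)
    - exp (- 2 * w j x) * (partial j (partial j (w i)) x + (partial j (w i) x)\<^sup>2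
        - 2 * partial j (w i) x * partial j (w j) x)
    - (\<Sum>m\<in>UNIV. exp (- 2 * w m x) * partial m (w i) x * partial m (w j) x))"
proof -
  have "coord_scalar_curvature (diagonal_metric w) x =
      (\<Sum>j\<in>UNIV. \<Sum>k\<in>UNIV. if j = k then exp (- 2 * w j x) * ricci (diagonal_metric w) j k x else 0)"
    unfolding coord_scalar_curvature_def matrix_inv_diagonal_metric
    by (intro sum.cong) auto
  also have "\<dots> = (\<Sum>j\<in>UNIV. \<Sum>i\<in>UNIV. exp (- 2 * w j x) * riemann (diagonal_metric w) i j i j x)"
    by (simp add: ricci_def sum_distrib_left)
  finally show ?thesis
    \<comment> \<open>For \<open>i = j\<close> the curvature component vanishes by antisymmetry,
      which unfolding \<open>riemann_def\<close> exposes.\<close>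
    using riemann_diagonal_metric[of w, OF w w']
    by (auto intro!: sum.cong simp: riemann_def)
qed

section \<open>The metric and its scalar curvature\<close>

definition planar :: "real^(2 + 'k::finite) \<Rightarrow> real^2" where
  "planar x = (\<chi> i. x $ Inl i)"

lemma bounded_linear_planar: "bounded_linear planar"
  unfolding linear_conv_bounded_linear[symmetric]
  by (rule linearI) (simp_all add: planar_def vec_eq_iff)

lemmas has_derivative_planar [derivative_intros] =
  bounded_linear.has_derivative[OF bounded_linear_planar]

lemma planar_axis [simp]: "planar (axis (Inl a) c) = axis a c" "planar (axis (Inr b) c) = 0"
  by (auto simp: planar_def axis_def vec_eq_iff)

lemma fst_plane_torus_covering [simp]: "fst (plane_torus_covering x) = planar x"
  by (simp add: plane_torus_covering_def planar_def)

definition quad :: "'a::real_inner \<Rightarrow> real" where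
  "quad y = 1 + y \<bullet> y"

text \<open>Half the logarithm of \<open>quad\<close> is a smooth substitute for ln |y|, the axial
  coordinate of the cigar's end. The summand 2 gives \<open>ell y \<ge> 2\<close>, which the
  curvature estimate needs at the core, and makes \<open>ell y powr \<alpha>\<close> at least
  1.\<close>

definition ell :: "'a::real_inner \<Rightarrow> real" where
  "ell y = 2 + ln (quad y) / 2"

lemma quad_ge_1: "quad y \<ge> 1"
  by (simp add: quad_def)

lemma quad_pos [simp]: "quad y > 0"
  using quad_ge_1[of y] by linarith

lemma quad_neq_0 [simp]: "quad y \<noteq> 0"
  using quad_pos[of y] by linarith

lemma ell_ge_2: "ell y \<ge> 2"
  using quad_ge_1[of y] by (simp add: ell_def)

lemma ell_pos [simp]: "ell y > 0"
  using ell_ge_2[of y] by linarith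

lemma ell_neq_0 [simp]: "ell y \<noteq> 0"
  using ell_pos[of y] by linarith

lemma has_derivative_quad [derivative_intros]:
  "(f has_derivative f') (at x within S) \<Longrightarrow>
   ((\<lambda>x. quad (f x)) has_derivative (\<lambda>h. 2 * (f x \<bullet> f' h))) (at x within S)"
  unfolding quad_def by (auto intro!: derivative_eq_intros simp: inner_commute)

lemma has_derivative_ell [derivative_intros]:
  "(f has_derivative f') (at x within S) \<Longrightarrow>
   ((\<lambda>x. ell (f x)) has_derivative (\<lambda>h. (f x \<bullet> f' h) / quad (f x))) (at x within S)"
  unfolding ell_def by (auto intro!: derivative_eq_intros simp: field_simps)

definition log_scale :: "real \<Rightarrow> 2 + 'k::finite \<Rightarrow> real^(2 + 'k) \<Rightarrow> real" where
  "log_scale \<alpha> i x = \<alpha> * ln (ell (planar x)) - (case i of Inl _ \<Rightarrow> ln (quad (planar x)) / 2 | Inr _ \<Rightarrow> 0)"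

lemma log_scale_simps:
  "log_scale \<alpha> (Inl a) = (\<lambda>x. \<alpha> * ln (ell (planar x)) - ln (quad (planar x)) / 2)"
  "log_scale \<alpha> (Inr b) = (\<lambda>x. \<alpha> * ln (ell (planar x)))"
  by (simp_all add: log_scale_def fun_eq_iff)

text \<open>\<open>log_scale\<close> depends only on the squared norm of the plane coordinate
  \<open>y\<close>, so its plane gradient is a scalar multiple of \<open>y\<close>; this is the
  scalar.\<close>

definition slope :: "real \<Rightarrow> 2 + 'k::finite \<Rightarrow> real^2 \<Rightarrow> real" where
  "slope \<alpha> i y = (\<alpha> / ell y - (case i of Inl _ \<Rightarrow> 1 | Inr _ \<Rightarrow> 0)) / quad y"

lemma has_derivative_log_scale:
  "(log_scale \<alpha> i has_derivative (\<lambda>h. (planar x \<bullet> planar h) * slope \<alpha> i (planar x))) (at x)"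
  by (cases i) (auto intro!: derivative_eq_intros simp: log_scale_simps slope_def field_simps)

lemma partial_log_scale:
  "partial m (log_scale \<alpha> i) = (\<lambda>x. (planar x \<bullet> planar (axis m 1)) * slope \<alpha> i (planar x))"
  by (rule ext) (rule partial_has_derivative[OF has_derivative_log_scale])

text \<open>The same scalar for the gradient of \<open>slope\<close>. The plane Hessian of
  \<open>log_scale\<close> is therefore \<open>slope\<close> times the identity plus
  \<open>slope_slope\<close> times the outer square of \<open>y\<close>.\<close>

definition slope_slope :: "real \<Rightarrow> 2 + 'k::finite \<Rightarrow> real^2 \<Rightarrow> real" where
  "slope_slope \<alpha> i y = - \<alpha> / ((ell y)\<^sup>2 * (quad y)\<^sup>2) - 2 * slope \<alpha> i y / quad y"

lemma has_derivative_slope: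
  "((\<lambda>x. slope \<alpha> i (planar x)) has_derivative
     (\<lambda>h. (planar x \<bullet> planar h) * slope_slope \<alpha> i (planar x))) (at x)"
  unfolding slope_def
  by (rule derivative_eq_intros refl | simp)+
    (simp add: slope_slope_def slope_def fun_eq_iff field_simps power2_eq_square)

lemma has_derivative_partial_log_scale:
  "(partial m (log_scale \<alpha> i) has_derivative
     (\<lambda>h. (planar h \<bullet> planar (axis m 1)) * slope \<alpha> i (planar x)
        + (planar x \<bullet> planar (axis m 1)) * ((planar x \<bullet> planar h) * slope_slope \<alpha> i (planar x)))) (at x)"
  unfolding partial_log_scale
  by (rule derivative_eq_intros has_derivative_slope refl | simp add: add.commute)+

lemma partial_partial_log_scale:
  "partial m (partial m (log_scale \<alpha> i)) x =
     (planar (axis m 1) \<bullet> planar (axis m 1)) * slope \<alpha> i (planar x)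
        + (planar x \<bullet> planar (axis m 1))\<^sup>2 * slope_slope \<alpha> i (planar x)"
  by (subst partial_has_derivative[OF has_derivative_partial_log_scale]) (simp add: power2_eq_square)

section \<open>Scalar curvature of the plane-torus metric\<close>

lemma sum_UNIV_Plus:
  "(\<Sum>i\<in>(UNIV::('a::finite + 'b::finite) set). f i) = (\<Sum>a\<in>UNIV. f (Inl a)) + (\<Sum>b\<in>UNIV. f (Inr b))"
  by (simp add: sum.Plus flip: UNIV_Plus_UNIV)

lemma sum_off_diagonal:
  "(\<Sum>i\<in>(UNIV::'a::finite set). if i = j then 0 else c) = (real CARD('a) - 1) * c"
proof -
  have "(\<Sum>i\<in>UNIV. if i = j then 0 else c) = (\<Sum>i\<in>(UNIV::'a set). c - (if i = j then c else 0))"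
    by (intro sum.cong) auto
  then show ?thesis
    by (simp add: sum_subtractf algebra_simps)
qed

definition plane_torus_metric :: "real \<Rightarrow> real^(2 + 'k::finite) \<Rightarrow> real^(2 + 'k)^(2 + 'k)" where
  "plane_torus_metric \<alpha> = diagonal_metric (log_scale \<alpha>)"

text \<open>The bracket is $-2\Delta u - 2k\Delta v - k(k+1)|\nabla v|^2$ for the metric
  $e^{2u}|dx|^2 + e^{2v}|d\varphi|^2$.\<close>

lemma coord_scalar_curvature_plane_torus:
  fixes x :: "real^(2 + 'k::finite)" and a :: 2 and b :: 'k
  defines "k \<equiv> real CARD('k)"
    and "y \<equiv> planar x"
  shows "coord_scalar_curvature (plane_torus_metric \<alpha>) x = exp (- 2 * log_scale \<alpha> (Inl a) x) *
    (- 2 * (2 * slope \<alpha> (Inl a :: 2 + 'k) y + (quad y - 1) * slope_slope \<alpha> (Inl a :: 2 + 'k) y)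
     - 2 * k * (2 * slope \<alpha> (Inr b :: 2 + 'k) y + (quad y - 1) * slope_slope \<alpha> (Inr b :: 2 + 'k) y)
     - k * (k + 1) * (quad y - 1) * (slope \<alpha> (Inr b :: 2 + 'k) y)\<^sup>2)"
proof -
  have dif: "log_scale \<alpha> i differentiable (at z)" "partial m (log_scale \<alpha> i) differentiable (at z)"
    for i m and z :: "real^(2 + 'k)"
    using has_derivative_log_scale has_derivative_partial_log_scale unfolding differentiable_def by blast+
  define Eu where "Eu = exp (- 2 * log_scale \<alpha> (Inl a) x)"
  define Ev where "Ev = exp (- 2 * log_scale \<alpha> (Inr b) x)"
  define Ku where "Ku = slope \<alpha> (Inl a :: 2 + 'k) y"
  define Kv where "Kv = slope \<alpha> (Inr b :: 2 + 'k) y"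
  define Hu where "Hu = slope_slope \<alpha> (Inl a :: 2 + 'k) y"
  define Hv where "Hv = slope_slope \<alpha> (Inr b :: 2 + 'k) y"
  \<comment> \<open>Scales and slopes depend only on whether an index is a plane or a torus index,
    so \<open>a\<close> and \<open>b\<close> are mere representatives.\<close>
  have E: "exp (- 2 * log_scale \<alpha> (Inl i) x) = Eu" "exp (- 2 * log_scale \<alpha> (Inr j) x) = Ev" for i j
    by (simp_all add: Eu_def Ev_def log_scale_def)
  have K: "slope \<alpha> (Inl i :: 2 + 'k) y = Ku" "slope \<alpha> (Inr j :: 2 + 'k) y = Kv" 
    "slope_slope \<alpha> (Inl i :: 2 + 'k) y = Hu" "slope_slope \<alpha> (Inr j :: 2 + 'k) y = Hv" for i j
    by (simp_all add: Ku_def Kv_def Hu_def Hv_def slope_slope_def slope_def)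
  have D: "partial (Inl i) (log_scale \<alpha> (Inl l)) x = y $ i * Ku"
    "partial (Inl i) (log_scale \<alpha> (Inr j)) x = y $ i * Kv"
    "partial (Inr j) (log_scale \<alpha> q) x = 0" for i l j and q :: "2 + 'k"
    by (simp_all add: partial_log_scale K inner_axis flip: y_def)
  have DD: "partial (Inl i) (partial (Inl i) (log_scale \<alpha> (Inl l))) x = Ku + (y $ i)\<^sup>2 * Hu"
    "partial (Inl i) (partial (Inl i) (log_scale \<alpha> (Inr j))) x = Kv + (y $ i)\<^sup>2 * Hv"
    "partial (Inr j) (partial (Inr j) (log_scale \<alpha> q)) x = 0" for i l j and q :: "2 + 'k"
    by (simp_all add: partial_partial_log_scale K inner_axis flip: y_def)
  have q: "quad y - 1 = (y $ 1)\<^sup>2 + (y $ 2)\<^sup>2"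
    by (simp add: quad_def inner_vec_def sum_2 power2_eq_square)
  show ?thesis
    unfolding plane_torus_metric_def scalar_curvature_diagonal_metric[of "log_scale \<alpha>", OF dif]
    \<comment> \<open>The double sum splits into plane and torus blocks. Torus derivatives vanish,
      so \<open>Ev\<close> drops out and equal torus terms are counted with multiplicities
      \<open>k\<close> and \<open>k - 1\<close>.\<close>
    unfolding sum_UNIV_Plus sum_2 E D DD K q
    by (simp add: sum_off_diagonal E D DD flip: k_def)
     (simp add: algebra_simps power2_eq_square)
qed

lemma exp_log_scale:
  "exp (2 * log_scale \<alpha> (Inl a) x) = ell (planar x) powr (2 * \<alpha>) / quad (planar x)"
  "exp (2 * log_scale \<alpha> (Inr b) x) = ell (planar x) powr (2 * \<alpha>)"
  by (simp_all add: log_scale_def powr_def algebra_simps exp_diff)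

text \<open>The exact value is (4 (1 - 1/L) + (s - 1)(1 + \<alpha>)/L^2) / (s L^(2\<alpha>)). The
  4/s comes from the cigar, and 1 + \<alpha> arises as 2 - k \<alpha>, because k \<alpha> = 1 -
  \<alpha>. The target has \<open>s\<close> in place of \<open>s - 1\<close>; the first summand
  makes up the difference.\<close>

lemma coord_scalar_curvature_plane_torus_gt:
  fixes x :: "real^(2 + 'k::finite)"
  assumes \<alpha>: "\<alpha> * (real CARD('k) + 1) = 1"
  shows "coord_scalar_curvature (plane_torus_metric \<alpha>) x > (1 + \<alpha>) / ell (planar x) powr (2 + 2 * \<alpha>)"
proof -
  define s where "s = quad (planar x)"
  define L where "L = ell (planar x)"
  define k where "k = real CARD('k)"
  have s: "s > 0" and L: "L \<ge> 2"
    using ell_ge_2[of "planar x"] by (simp_all add: s_def L_def)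
  have "\<alpha> > 0"
    using \<alpha> by (metis add_increasing2 of_nat_0_le_iff zero_less_mult_pos2 zero_less_one zero_le_one add_pos_nonneg add.commute)
  have "\<alpha> \<le> 1"
    using \<alpha> \<open>\<alpha> > 0\<close> by (metis add_increasing le_add_same_cancel2 mult.right_neutral mult_left_mono of_nat_0_le_iff order_less_imp_le)
  have e: "exp (- 2 * log_scale \<alpha> (Inl a) x) = s / L powr (2 * \<alpha>)" for a
    using exp_log_scale(1)[of \<alpha> a x] by (simp add: exp_minus s_def L_def)
  \<comment> \<open>The difference of the sides is 4 (1 - 1/L) - (1 + \<alpha>)/L^2. With L at least
    2 and \<alpha> at most 1, the first term is at least 2 and the second at most 1/2.\<close>
  have "4 * (1 - 1 / L) + (s - 1) * (1 + \<alpha>) / L\<^sup>2 > s * (1 + \<alpha>) / L\<^sup>2"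
  proof -
    have "(1 + \<alpha>) / L\<^sup>2 \<le> 2 / 2\<^sup>2"
      using L \<open>\<alpha> \<le> 1\<close> \<open>\<alpha> > 0\<close> by (intro frac_le power_mono) auto
    moreover have "1 / L \<le> 1 / 2"
      using L by (simp add: field_simps)
    moreover have "c \<le> 2 / 2\<^sup>2 \<Longrightarrow> d \<le> 1 / 2 \<Longrightarrow> 4 * (1 - d) - c > 0" for c d :: real
      by (simp add: power2_eq_square)
    ultimately have "4 * (1 - 1 / L) - (1 + \<alpha>) / L\<^sup>2 > 0"
      by blast
    then show ?thesis
      by (simp add: diff_divide_distrib left_diff_distrib)
  qed
  then have "s * (1 + \<alpha>) / L\<^sup>2 * (1 / (s * L powr (2 * \<alpha>))) <
      (4 * (1 - 1 / L) + (s - 1) * (1 + \<alpha>) / L\<^sup>2) * (1 / (s * L powr (2 * \<alpha>)))"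
    using s L by (intro mult_strict_right_mono) auto
  moreover have "s * (1 + \<alpha>) / L\<^sup>2 * (1 / (s * L powr (2 * \<alpha>))) = (1 + \<alpha>) / L powr (2 + 2 * \<alpha>)"
    using s L by (simp add: powr_add powr_numeral)
  moreover have "coord_scalar_curvature (plane_torus_metric \<alpha>) x =
      (4 * (1 - 1 / L) + (s - 1) * (1 + \<alpha>) / L\<^sup>2) * (1 / (s * L powr (2 * \<alpha>)))"
  proof -
    \<comment> \<open>Eliminating \<open>k\<close> turns the curvature formula into a rational
      identity in \<open>s\<close>, \<open>L\<close> and \<alpha>.\<close>
    have k: "k = 1 / \<alpha> - 1"
      using \<alpha> \<open>\<alpha> > 0\<close> by (simp add: k_def field_simps)
    show ?thesis
      unfolding coord_scalar_curvature_plane_torus[of \<alpha> x undefined undefined] e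
      unfolding slope_slope_def slope_def s_def[symmetric] L_def[symmetric] k_def[symmetric] k
      using s L \<open>\<alpha> > 0\<close> by (simp add: field_simps power2_eq_square)
  qed
  ultimately show ?thesis
    by (simp add: L_def)
qed

section \<open>Smoothness and invariance under transitions\<close>

text \<open>An algebra of functions containing the metric components and closed under directional
  derivatives, so smoothness of every order follows by induction. Differentiation lowers the
  exponent of \<open>ell\<close> by one, hence the arbitrary exponent \<open>b\<close> in
  \<open>ell_powr\<close>.\<close>

inductive elementary :: "(real^(2 + 'k::finite) \<Rightarrow> real) \<Rightarrow> bool" where
  const: "elementary (\<lambda>x. c)"
| coord: "elementary (\<lambda>x. planar x \<bullet> a)"
| ell_powr: "elementary (\<lambda>x. ell (planar x) powr b)"
| inverse_quad: "elementary (\<lambda>x. inverse (quad (planar x)))"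
| add: "elementary f \<Longrightarrow> elementary g \<Longrightarrow> elementary (\<lambda>x. f x + g x)"
| mult: "elementary f \<Longrightarrow> elementary g \<Longrightarrow> elementary (\<lambda>x. f x * g x)"

lemma elementary_has_derivative:
  fixes f :: "real^(2 + 'k::finite) \<Rightarrow> real"
  assumes "elementary f"
  shows "\<exists>D. (\<forall>x. (f has_derivative D x) (at x)) \<and> (\<forall>v. elementary (\<lambda>x. D x v))"
  using assms
proof induction
  case (const c)
  show ?case
    by (intro exI[of _ "\<lambda>x v. 0"]) (auto intro: elementary.intros)
next
  case (coord a)
  show ?case
    by (intro exI[of _ "\<lambda>x v. planar v \<bullet> a"])
      (auto intro!: elementary.intros derivative_eq_intros)
next
  case (ell_powr b)
  let ?D = "\<lambda>x v. b * (ell (planar x) powr (b - 1) * ((planar x \<bullet> planar v) * inverse (quad (planar x))))"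
  have "((\<lambda>x. ell (planar x) powr b) has_derivative ?D x) (at x)" for x :: "real^(2 + 'k)"
    by (rule derivative_eq_intros refl | simp)+
      (simp add: fun_eq_iff field_simps powr_diff abs_of_pos)
  moreover have "elementary (\<lambda>x. ?D x v)" for v
    by (intro elementary.intros)
  ultimately show ?case by (intro exI[of _ ?D]) blast
next
  case inverse_quad
  let ?D = "\<lambda>x v. (- 2) * ((planar x \<bullet> planar v) * (inverse (quad (planar x)) * inverse (quad (planar x))))"
  have "((\<lambda>x. inverse (quad (planar x))) has_derivative ?D x) (at x)" for x :: "real^(2 + 'k)"
    by (rule derivative_eq_intros refl | simp)+ (simp add: fun_eq_iff field_simps)
  moreover have "elementary (\<lambda>x. ?D x v)" for v
    by (intro elementary.intros)
  ultimately show ?case by (intro exI[of _ ?D]) blast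
next
  case (add f g)
  then obtain D E where D: "\<forall>x. (f has_derivative D x) (at x)" "\<forall>v. elementary (\<lambda>x. D x v)"
    and E: "\<forall>x. (g has_derivative E x) (at x)" "\<forall>v. elementary (\<lambda>x. E x v)"
    by blast
  then show ?case
    by (intro exI[of _ "\<lambda>x v. D x v + E x v"])
      (auto intro: elementary.intros derivative_intros)
next
  case (mult f g)
  then obtain D E where D: "\<forall>x. (f has_derivative D x) (at x)" "\<forall>v. elementary (\<lambda>x. D x v)"
    and E: "\<forall>x. (g has_derivative E x) (at x)" "\<forall>v. elementary (\<lambda>x. E x v)"
    by blast
  then show ?case
    using mult.hyps
    by (intro exI[of _ "\<lambda>x v. f x * E x v + D x v * g x"])
      (auto intro!: elementary.intros has_derivative_mult)
qed

lemma elementary_smooth_on: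
  assumes "elementary f"
  shows "smooth_on f S"
  unfolding smooth_on_def
proof
  show "times_differentiable_on k f S" for k
    using assms
  proof (induction k arbitrary: f)
    case 0
    then show ?case
      using elementary_has_derivative[OF 0]
      by (auto intro!: continuous_at_imp_continuous_on intro: has_derivative_continuous)
  next
    case (Suc k)
    obtain D where D: "\<And>x. (f has_derivative D x) (at x)" "\<And>v. elementary (\<lambda>x. D x v)"
      using elementary_has_derivative[OF Suc.prems] by blast
    then have "frechet_derivative f (at x) = D x" for x
      using frechet_derivative_at by metis
    with D Suc.IH show ?case
      by (auto simp: differentiable_def)
  qed
qed

section \<open>Metric components: smoothness, positivity, independence of the chart\<close>

lemma plane_torus_metric_nth:
  "plane_torus_metric \<alpha> x $ i $ j =
    (if i = j then ell (planar x) powr (2 * \<alpha>) * (case i of Inl _ \<Rightarrow> inverse (quad (planar x)) | Inr _ \<Rightarrow> 1) else 0)"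
  by (auto simp: plane_torus_metric_def diagonal_metric_def exp_log_scale field_simps split: sum.split)

lemma smooth_on_plane_torus_metric: "smooth_on (\<lambda>x. plane_torus_metric \<alpha> x $ i $ j) S"
proof (rule elementary_smooth_on)
  show "elementary (\<lambda>x. plane_torus_metric \<alpha> x $ i $ j)"
    unfolding plane_torus_metric_nth
    by (cases "i = j"; cases i) (auto intro!: elementary.intros)
qed

lemma transpose_plane_torus_metric: "transpose (plane_torus_metric \<alpha> x) = plane_torus_metric \<alpha> x"
  by (auto simp: plane_torus_metric_def diagonal_metric_def transpose_def vec_eq_iff)

lemma plane_torus_metric_cong: "planar x = planar y \<Longrightarrow> plane_torus_metric \<alpha> x = plane_torus_metric \<alpha> y"
  by (simp add: vec_eq_iff[of "plane_torus_metric \<alpha> x"] vec_eq_iff[of "plane_torus_metric \<alpha> x $ _"]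
      plane_torus_metric_nth split: sum.split)

lemma plane_torus_metric_quadratic_form:
  fixes v :: "real^(2 + 'k::finite)"
  shows "v \<bullet> (plane_torus_metric \<alpha> x *v v) = 
    ell (planar x) powr (2 * \<alpha>) * ((norm (planar v))\<^sup>2 / quad (planar x) + (\<Sum>j\<in>UNIV. (v $ Inr j)\<^sup>2))"
proof -
  have "(plane_torus_metric \<alpha> x *v v) $ i = plane_torus_metric \<alpha> x $ i $ i * v $ i" for i
    by (simp add: matrix_vector_mult_def plane_torus_metric_nth if_distrib[where f = "\<lambda>c. c * _"] cong: if_cong)
  then have "v \<bullet> (plane_torus_metric \<alpha> x *v v) = (\<Sum>i\<in>UNIV. plane_torus_metric \<alpha> x $ i $ i * (v $ i)\<^sup>2)"
    by (simp add: inner_vec_def power2_eq_square mult_ac)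
  also have "\<dots> = ell (planar x) powr (2 * \<alpha>) * ((norm (planar v))\<^sup>2 / quad (planar x) + (\<Sum>j\<in>UNIV. (v $ Inr j)\<^sup>2))"
    unfolding sum_UNIV_Plus dot_square_norm[symmetric] inner_vec_def
    by (simp add: plane_torus_metric_nth planar_def algebra_simps sum_distrib_left sum_distrib_right
      divide_inverse power2_eq_square)
  finally show ?thesis .
qed

lemma plane_torus_metric_pos:
  assumes "v \<noteq> 0"
  shows "0 < v \<bullet> (plane_torus_metric \<alpha> x *v v)"
proof -
  have nn: "(norm (planar v))\<^sup>2 / quad (planar x) \<ge> 0" "(\<Sum>j\<in>UNIV. (v $ Inr j)\<^sup>2) \<ge> 0"
    by (simp_all add: sum_nonneg less_imp_le)
  have "(norm (planar v))\<^sup>2 / quad (planar x) + (\<Sum>j\<in>UNIV. (v $ Inr j)\<^sup>2) \<noteq> 0"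
  proof
    assume "(norm (planar v))\<^sup>2 / quad (planar x) + (\<Sum>j\<in>UNIV. (v $ Inr j)\<^sup>2) = 0"
    with nn have "planar v = 0" "\<forall>j. v $ Inr j = 0"
      by (auto simp: add_nonneg_eq_0_iff sum_nonneg_eq_0_iff)
    then have "v $ i = 0" for i
      by (cases i) (auto simp: planar_def vec_eq_iff)
    with assms show False
      by (simp add: vec_eq_iff)
  qed
  with nn have "(norm (planar v))\<^sup>2 / quad (planar x) + (\<Sum>j\<in>UNIV. (v $ Inr j)\<^sup>2) > 0"
    by linarith
  then show ?thesis
    unfolding plane_torus_metric_quadratic_form by (intro mult_pos_pos) simp_all
qed

text \<open>Charts are local sections of the covering. This is what turns chart-dependent
  coordinates back into data of the point itself, such as \<open>fst p\<close> for the planar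
  part.\<close>

lemma chart_covering:
  assumes "c \<in> plane_torus_atlas" "p \<in> fst c"
  shows "plane_torus_covering (snd c p) = p"
  using assms by (auto simp: plane_torus_atlas_def plane_torus_chart_def inv_into_f_f inj_on_angle_box)

text \<open>A transition is locally a translation, so its Jacobian is the identity. Both coordinate
  vectors cover the same point, so their planar parts, and with them the matrices, agree.\<close>

lemma riemannian_metric_plane_torus:
  "riemannian_metric plane_torus_atlas (\<lambda>c. plane_torus_metric \<alpha> :: real^(2 + 'k::finite) \<Rightarrow> _)"
proof -
  have "plane_torus_metric \<alpha> x = transpose J ** plane_torus_metric \<alpha> (transition c c' x) ** J"
    if c: "c \<in> plane_torus_atlas" "c' \<in> plane_torus_atlas" and x: "x \<in> snd c ` (fst c \<inter> fst c')"
      and J: "J = jacobian (transition c c') (at x)"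
    for c c' :: "((real^2) \<times> (complex^'k), 2 + 'k) chart" and x J
  proof -
    obtain p where p: "p \<in> fst c" "p \<in> fst c'" "x = snd c p"
      using x by blast
    obtain a b where ab: "c = plane_torus_chart a" "c' = plane_torus_chart b"
      using c by (auto simp: plane_torus_atlas_def)
    have px: "plane_torus_covering x = p"
      using chart_covering c p by blast
    have xa: "x \<in> angle_box a"
      using p chart_image_plane_torus_chart[of a] by (auto simp: chart_image_def ab)
    moreover have "plane_torus_covering x \<in> plane_torus_covering ` angle_box b"
      using p px by (simp add: ab fst_plane_torus_chart)
    ultimately obtain d T where T: "open T" "x \<in> T" "T \<subseteq> angle_box a"
      "\<And>y. y \<in> T \<Longrightarrow> transition c c' y = y + d"
      unfolding ab by (rule transition_plane_torus_chart) blast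
    have "((\<lambda>y. y + d) has_derivative (\<lambda>v. v)) (at x)"
      by (auto intro!: derivative_eq_intros)
    then have "(transition c c' has_derivative (\<lambda>v. v)) (at x)"
      using has_derivative_transform_within_open[OF _ T(1,2)] T(4) by metis
    then have "J = mat 1"
      using frechet_derivative_at[of "transition c c'" "\<lambda>v. v" x] matrix_id_mat_1
      by (simp add: J jacobian_def flip: id_def)
    have "inj_on (snd c) (fst c)"
      by (auto simp: ab plane_torus_chart_def inj_on_inv_into)
    then have "transition c c' x = snd c' p"
      using p by (simp add: transition_def inv_into_f_f)
    then have "plane_torus_covering (transition c c' x) = p"
      using chart_covering c p by metis
    then have "planar (transition c c' x) = planar x"
      using px fst_plane_torus_covering by metis
    then have "plane_torus_metric \<alpha> (transition c c' x) = plane_torus_metric \<alpha> x"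
      by (rule plane_torus_metric_cong)
    with \<open>J = mat 1\<close> show ?thesis
      by (simp add: transpose_mat)
  qed
  then show ?thesis
    by (auto simp: riemannian_metric_def Let_def smooth_on_plane_torus_metric
        transpose_plane_torus_metric plane_torus_metric_pos)
qed

lemma chart_at_plane_torus:
  assumes "p \<in> plane_times_torus"
  shows "chart_at plane_torus_atlas p \<in> plane_torus_atlas" "p \<in> fst (chart_at plane_torus_atlas p)"
proof -
  have "\<exists>c. c \<in> plane_torus_atlas \<and> p \<in> fst c"
    using assms smooth_atlas_plane_torus_atlas unfolding smooth_atlas_def by blast
  then have "chart_at plane_torus_atlas p \<in> plane_torus_atlas \<and> p \<in> fst (chart_at plane_torus_atlas p)"
    unfolding chart_at_def by (rule someI_ex)
  then show "chart_at plane_torus_atlas p \<in> plane_torus_atlas" "p \<in> fst (chart_at plane_torus_atlas p)"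
    by auto
qed

lemma scalar_curvature_plane_torus_gt:
  fixes p :: "(real^2) \<times> (complex^'k::finite)"
  assumes "\<alpha> * (real CARD('k) + 1) = 1" and p: "p \<in> plane_times_torus"
  shows "scalar_curvature plane_torus_atlas (\<lambda>c. plane_torus_metric \<alpha>) p
    > (1 + \<alpha>) / ell (fst p) powr (2 + 2 * \<alpha>)"
proof -
  define x where "x = snd (chart_at plane_torus_atlas p) p"
  have "plane_torus_covering x = p"
    unfolding x_def by (intro chart_covering chart_at_plane_torus p)
  then have "planar x = fst p"
    using fst_plane_torus_covering by metis
  with coord_scalar_curvature_plane_torus_gt[OF assms(1), of x] show ?thesis
    by (simp add: scalar_curvature_def Let_def x_def)
qed

section \<open>Reparametrisation of piecewise C1 curves\<close>

text \<open>\<open>m\<close> may be negative, so one lemma serves path reversal and both halves of a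
  join; stating the image of the interval avoids a case split on orientation.\<close>

lemma C1_curve_on_affine:
  fixes \<gamma> \<delta> :: "real \<Rightarrow> 'a" and A :: "('a, 'm::finite) chart set"
  assumes C1: "C1_curve_on A \<gamma> a b"
    and image: "(\<lambda>t. m * t + e) ` {a'..b'} = {a..b}"
    and \<delta>: "\<And>t. t \<in> {a'..b'} \<Longrightarrow> \<delta> t = \<gamma> (m * t + e)"
  shows "C1_curve_on A \<delta> a' b'"
  unfolding C1_curve_on_def Let_def
proof
  fix c assume "c \<in> A"
  let ?T = "{t \<in> {a..b}. \<gamma> t \<in> fst c}" and ?T' = "{t \<in> {a'..b'}. \<delta> t \<in> fst c}"
  obtain v where v: "continuous_on ?T v"
    "\<forall>t\<in>?T. (snd c \<circ> \<gamma> has_vector_derivative v t) (at t within {a..b})"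
    using C1 \<open>c \<in> A\<close> unfolding C1_curve_on_def Let_def by blast
  have T': "m * t + e \<in> ?T" if "t \<in> ?T'" for t
  proof -
    have t: "t \<in> {a'..b'}" "\<delta> t \<in> fst c"
      using that by auto
    have "m * t + e \<in> {a..b}"
      unfolding image[symmetric] using t(1) by (rule imageI)
    with t(2) show ?thesis
      unfolding \<delta>[OF t(1)] by simp
  qed
  have "continuous_on ?T' (\<lambda>t. m *\<^sub>R v (m * t + e))"
    by (intro continuous_intros continuous_on_compose2[OF v(1)]) (rule image_subsetI T')+
  moreover have "(snd c \<circ> \<delta> has_vector_derivative m *\<^sub>R v (m * t + e)) (at t within {a'..b'})"
    if t: "t \<in> ?T'" for t
  proof -
    have "((\<lambda>t. m * t + e) has_vector_derivative m) (at t within {a'..b'})"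
      by (auto intro!: derivative_eq_intros)
    from vector_diff_chain_within[OF this] bspec[OF v(2) T'[OF t]]
    have "((snd c \<circ> \<gamma>) \<circ> (\<lambda>t. m * t + e) has_vector_derivative m *\<^sub>R v (m * t + e)) (at t within {a'..b'})"
      unfolding image by blast
    then show ?thesis
      by (rule has_vector_derivative_transform[rotated 2]) (use t in \<open>simp_all add: \<delta>\<close>)
  qed
  ultimately show "\<exists>v. continuous_on ?T' v \<and>
      (\<forall>t\<in>?T'. (snd c \<circ> \<delta> has_vector_derivative v t) (at t within {a'..b'}))"
    by blast
qed

text \<open>Restricted to interior times because \<open>speed\<close> uses the two-sided derivative,
  while \<open>C1_curve_on\<close> provides derivatives within a closed interval. Both sides use the
  same chart, since \<open>chart_at\<close> depends only on the point.\<close>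

lemma speed_affine:
  fixes \<gamma> \<delta> :: "real \<Rightarrow> 'a" and A :: "('a, 'm::finite) chart set"
  assumes C1: "C1_curve_on A \<gamma> a b" and t: "m * t + e \<in> {a<..<b}"
    and U: "open U" "t \<in> U" "\<And>s. s \<in> U \<Longrightarrow> \<delta> s = \<gamma> (m * s + e)"
    and chart: "chart_at A (\<delta> t) \<in> A" "\<delta> t \<in> fst (chart_at A (\<delta> t))"
  shows "speed A g \<delta> t = \<bar>m\<bar> * speed A g \<gamma> (m * t + e)"
proof -
  define c where "c = chart_at A (\<delta> t)"
  have \<delta>t: "\<delta> t = \<gamma> (m * t + e)"
    using U by blast
  then have "m * t + e \<in> {t \<in> {a..b}. \<gamma> t \<in> fst c}"
    using chart t by (simp add: c_def)
  moreover obtain w where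
    "\<forall>t\<in>{t \<in> {a..b}. \<gamma> t \<in> fst c}. (snd c \<circ> \<gamma> has_vector_derivative w t) (at t within {a..b})"
    using C1 chart(1) unfolding C1_curve_on_def Let_def c_def[symmetric] by blast
  moreover define v where "v = w (m * t + e)"
  ultimately have "(snd c \<circ> \<gamma> has_vector_derivative v) (at (m * t + e) within {a..b})"
    by blast
  then have v: "(snd c \<circ> \<gamma> has_vector_derivative v) (at (m * t + e))"
    using t by (simp add: at_within_Icc_at)
  have "((\<lambda>t. m * t + e) has_vector_derivative m) (at t)"
    by (auto intro!: derivative_eq_intros)
  from vector_diff_chain_at[OF this v]
  have "(snd c \<circ> \<delta> has_vector_derivative m *\<^sub>R v) (at t)"
    by (rule has_vector_derivative_transform_within_open[OF _ U(1,2)]) (simp add: U(3))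
  then have "vector_derivative (snd c \<circ> \<delta>) (at t) = m *\<^sub>R v" "vector_derivative (snd c \<circ> \<gamma>) (at (m * t + e)) = v"
    using v by (auto intro: vector_derivative_at)
  moreover have "chart_at A (\<gamma> (m * t + e)) = c"
    using c_def \<delta>t by simp
  moreover define G where "G = g c (snd c (\<gamma> (m * t + e)))"
  ultimately have "speed A g \<delta> t = sqrt ((m *\<^sub>R v) \<bullet> (G *v (m *\<^sub>R v)))"
    "speed A g \<gamma> (m * t + e) = sqrt (v \<bullet> (G *v v))"
    by (simp_all only: speed_def Let_def \<delta>t)
  moreover have "(m *\<^sub>R v) \<bullet> (G *v (m *\<^sub>R v)) = m\<^sup>2 * (v \<bullet> (G *v v))"
    by (simp add: matrix_vector_mult_scaleR power2_eq_square)
  ultimately show ?thesis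
    by (simp only: real_sqrt_mult real_sqrt_abs)
qed

text \<open>The break-point clause of \<open>piecewise_C1_path\<close>, detached so that it also
  applies to break sets of a subinterval, such as one half of a joined path.\<close>

definition C1_pieces :: "('a, 'm::finite) chart set \<Rightarrow> (real \<Rightarrow> 'a) \<Rightarrow> real set \<Rightarrow> bool" where
  "C1_pieces A \<gamma> S \<longleftrightarrow> (\<forall>a\<in>S. \<forall>b\<in>S. a < b \<and> {a<..<b} \<inter> S = {} \<longrightarrow> C1_curve_on A \<gamma> a b)"

text \<open>The hypotheses make \<open>S'\<close> the preimage of \<open>S\<close> in the interval
  from \<open>l\<close> to \<open>r\<close>, so gaps between neighbouring points of
  \<open>S'\<close> map onto gaps of \<open>S\<close>.\<close>

lemma C1_pieces_affine:
  assumes "C1_pieces A \<gamma> S" "m \<noteq> 0"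
    and S': "\<And>t. t \<in> S' \<Longrightarrow> l \<le> t \<and> t \<le> r \<and> m * t + e \<in> S"
      "\<And>t. l \<le> t \<Longrightarrow> t \<le> r \<Longrightarrow> m * t + e \<in> S \<Longrightarrow> t \<in> S'"
    and \<delta>: "\<And>t. t \<in> {l..r} \<Longrightarrow> \<delta> t = \<gamma> (m * t + e)"
  shows "C1_pieces A \<delta> S'"
  unfolding C1_pieces_def
proof (intro ballI impI, elim conjE)
  fix a' b' assume ab: "a' \<in> S'" "b' \<in> S'" "a' < b'" "{a'<..<b'} \<inter> S' = {}"
  let ?s = "\<lambda>t. m * t + e"
  \<comment> \<open>A negative \<open>m\<close> swaps the endpoints.\<close>
  define a b where "a = min (?s a') (?s b')" and "b = max (?s a') (?s b')"
  have image: "?s ` {a'..b'} = {a..b}"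
    using ab(3) \<open>m \<noteq> 0\<close> unfolding a_def b_def image_affinity_atLeastAtMost[of m e]
    by (auto simp: mult_le_cancel_left min_def max_def)
  have "a < b"
    using ab(3) \<open>m \<noteq> 0\<close> by (auto simp: a_def b_def min_def max_def mult_le_cancel_left)
  have "a \<in> S" "b \<in> S"
    using S' ab by (auto simp: a_def b_def min_def max_def)
  moreover have "{a<..<b} \<inter> S = {}"
  proof (rule ccontr)
    assume "{a<..<b} \<inter> S \<noteq> {}"
    then obtain u where u: "a < u" "u < b" "u \<in> S" by auto
    then have "u \<in> ?s ` {a'..b'}" by (simp add: image)
    then obtain t where t: "t \<in> {a'..b'}" "u = ?s t" by blast
    with u have "t \<noteq> a'" "t \<noteq> b'" by (auto simp: a_def b_def)
    moreover have "t \<in> S'"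
      using S'(2)[of t] S'(1)[OF ab(1)] S'(1)[OF ab(2)] t u by auto
    moreover have "t \<in> {a'<..<b'}"
      using calculation t(1) by auto
    ultimately show False using ab(4) by blast
  qed
  ultimately have "C1_curve_on A \<gamma> a b"
    using assms(1) \<open>a < b\<close> by (auto simp: C1_pieces_def)
  then show "C1_curve_on A \<delta> a' b'"
    by (rule C1_curve_on_affine[OF _ image]) (use \<delta> S'(1)[OF ab(1)] S'(1)[OF ab(2)] in auto)
qed

text \<open>Puts a time that is not a break point inside an open C1 piece, where
  \<open>speed_affine\<close> applies. The ends of the gap are the nearest break points.\<close>

lemma finite_enclosing_gap:
  fixes t :: real
  assumes "finite S" "{0, 1} \<subseteq> S" "t \<in> {0..1} - S"
  obtains a b where "a \<in> S" "b \<in> S" "a < t" "t < b" "{a<..<b} \<inter> S = {}"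
proof -
  let ?L = "{s\<in>S. s < t}" and ?R = "{s\<in>S. t < s}"
  have S: "0 \<in> S" "1 \<in> S" and t: "0 \<le> t" "t \<le> 1" "t \<notin> S"
    using assms by auto
  then have "t \<noteq> 0" "t \<noteq> 1"
    by metis+
  with t have "0 < t" "t < 1"
    by simp_all
  with S have ne: "?L \<noteq> {}" "?R \<noteq> {}"
    by blast+
  have fin: "finite ?L" "finite ?R"
    using \<open>finite S\<close> by simp_all
  define a b where "a = Max ?L" and "b = Min ?R"
  have a: "a \<in> S" "a < t" and b: "b \<in> S" "t < b"
    using Max_in[OF fin(1) ne(1)] Min_in[OF fin(2) ne(2)] by (simp_all add: a_def b_def)
  have "u \<notin> S" if "a < u" "u < b" for u
  proof
    assume "u \<in> S"
    with t(3) consider "u \<in> ?L" | "u \<in> ?R"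
      by (cases u t rule: linorder_cases) auto
    then show False
    proof cases
      case 1
      then show False
        using Max_ge[OF fin(1) 1] \<open>a < u\<close> by (simp add: a_def)
    next
      case 2
      then show False
        using Min_le[OF fin(2) 2] \<open>u < b\<close> by (simp add: b_def)
    qed
  qed
  then have "{a<..<b} \<inter> S = {}"
    by auto
  with a b show ?thesis
    by (intro that)
qed

text \<open>Change of variables: the factor |m| from the speed cancels 1/|m| from the integral.
  Integrability is assumed so that \<open>curve_length\<close> is a genuine integral and not the
  default value 0.\<close>

lemma has_integral_speed_affine:
  fixes \<gamma> \<delta> :: "real \<Rightarrow> 'a" and A :: "('a, 'm::finite) chart set"
  assumes "C1_pieces A \<gamma> S" "finite S" "{0, 1} \<subseteq> S" "m \<noteq> 0"
    and image: "(\<lambda>t. m * t + e) ` {l..r} = {0..1}"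
    and \<delta>: "\<And>t. t \<in> {l..r} \<Longrightarrow> \<delta> t = \<gamma> (m * t + e)"
    and int: "speed A g \<gamma> integrable_on {0..1}"
    and chart: "\<And>t. t \<in> {0..1} \<Longrightarrow> chart_at A (\<gamma> t) \<in> A \<and> \<gamma> t \<in> fst (chart_at A (\<gamma> t))"
  shows "(speed A g \<delta> has_integral curve_length A g \<gamma>) {l..r}"
proof -
  let ?s = "\<lambda>t. m * t + e"
  have "(speed A g \<gamma> has_integral curve_length A g \<gamma>) (cbox 0 1)"
    using int by (simp add: curve_length_def integrable_integral)
  from has_integral_affinity[OF this \<open>m \<noteq> 0\<close>, of e]
  have "((\<lambda>t. speed A g \<gamma> (?s t)) has_integral curve_length A g \<gamma> / \<bar>m\<bar>)
      ((\<lambda>x. (1 / m) *\<^sub>R x + - ((1 / m) *\<^sub>R e)) ` {0..1})"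
    by simp
  also have "(\<lambda>x. (1 / m) *\<^sub>R x + - ((1 / m) *\<^sub>R e)) ` {0..1} = {l..r}"
    unfolding image[symmetric] image_image using \<open>m \<noteq> 0\<close> by (simp add: field_simps)
  finally have "((\<lambda>t. \<bar>m\<bar> * speed A g \<gamma> (?s t)) has_integral \<bar>m\<bar> * (curve_length A g \<gamma> / \<bar>m\<bar>)) {l..r}"
    by (rule has_integral_mult_right)
  then have *: "((\<lambda>t. \<bar>m\<bar> * speed A g \<gamma> (?s t)) has_integral curve_length A g \<gamma>) {l..r}"
    using \<open>m \<noteq> 0\<close> by simp
  have "inj ?s"
    using \<open>m \<noteq> 0\<close> by (auto simp: inj_on_def)
  \<comment> \<open>The exceptional times are the pulled-back break points, where the derivative may
    jump, and \<open>l\<close>, \<open>r\<close>, around which \<delta> is not known to follow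
    \<gamma>.\<close>
  then have fin: "finite (?s -` S \<union> {l, r})"
    using finite_vimageI[OF \<open>finite S\<close>] by blast
  show ?thesis
  proof (rule has_integral_spike_finite[OF fin _ *])
    fix t assume t: "t \<in> {l..r} - (?s -` S \<union> {l, r})"
    then have "t \<in> {l..r}" "?s t \<notin> S"
      by auto
    then have "?s t \<in> {0..1} - S"
      using image by blast
    then obtain a b where ab: "a \<in> S" "b \<in> S" "a < ?s t" "?s t < b" "{a<..<b} \<inter> S = {}"
      using finite_enclosing_gap assms(2,3) by metis
    then have "C1_curve_on A \<gamma> a b"
      using assms(1) by (auto simp: C1_pieces_def)
    then show "speed A g \<delta> t = \<bar>m\<bar> * speed A g \<gamma> (?s t)"
      by (rule speed_affine[where U = "{l<..<r}"])
        (use t ab \<delta> chart[of "?s t"] \<open>?s t \<in> {0..1} - S\<close> in auto)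
  qed
qed

section \<open>Reversed and joined paths\<close>

lemma piecewise_C1_path_reversepath:
  assumes "piecewise_C1_path M A \<gamma>"
  shows "piecewise_C1_path M A (reversepath \<gamma>)"
proof -
  obtain S where S: "finite S" "{0, 1} \<subseteq> S" "S \<subseteq> {0..1}" "C1_pieces A \<gamma> S"
    using assms unfolding piecewise_C1_path_def C1_pieces_def by blast
  let ?S = "(\<lambda>t. 1 - t) ` S"
  have "t \<in> ?S \<longleftrightarrow> 1 - t \<in> S" for t
    by (force simp: image_iff)
  then have "C1_pieces A (reversepath \<gamma>) ?S"
    using S(3) by (intro C1_pieces_affine[OF S(4), of "-1" _ 0 1 1]) (auto simp: reversepath_def)
  then show ?thesis
    using assms S(1-3) unfolding piecewise_C1_path_def C1_pieces_def
    by (intro conjI exI[of _ ?S]) (auto simp: image_iff)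
qed

text \<open>At time 1/2 \<open>joinpaths\<close> still uses the first path; the matching endpoints
  extend the second formula to the closed half.\<close>

lemma joinpaths_second_half:
  assumes "pathfinish \<gamma> = pathstart \<delta>" "t \<in> {1/2..1}"
  shows "(\<gamma> +++ \<delta>) t = \<delta> (2 * t - 1)"
proof (cases "t = 1/2")
  case True
  then show ?thesis
    using assms(1) unfolding True by (simp add: joinpaths_def pathfinish_def pathstart_def)
qed (use assms in \<open>auto simp: joinpaths_def\<close>)

lemma piecewise_C1_path_joinpaths:
  assumes \<gamma>: "piecewise_C1_path M A \<gamma>" and \<delta>: "piecewise_C1_path M A \<delta>"
    and "pathfinish \<gamma> = pathstart \<delta>"
  shows "piecewise_C1_path M A (\<gamma> +++ \<delta>)"
proof -
  obtain S where S: "finite S" "{0, 1} \<subseteq> S" "S \<subseteq> {0..1}" "C1_pieces A \<gamma> S"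
    using \<gamma> unfolding piecewise_C1_path_def C1_pieces_def by blast
  obtain T where T: "finite T" "{0, 1} \<subseteq> T" "T \<subseteq> {0..1}" "C1_pieces A \<delta> T"
    using \<delta> unfolding piecewise_C1_path_def C1_pieces_def by blast
  define S' where "S' = (\<lambda>t. t / 2) ` S"
  define T' where "T' = (\<lambda>t. (t + 1) / 2) ` T"
  have mem: "t \<in> S' \<longleftrightarrow> 2 * t + 0 \<in> S" "t \<in> T' \<longleftrightarrow> 2 * t + - 1 \<in> T" for t
  proof -
    have "t = s / 2 \<longleftrightarrow> s = 2 * t + 0" "t = (s + 1) / 2 \<longleftrightarrow> s = 2 * t + - 1" for s
      by auto
    then show "t \<in> S' \<longleftrightarrow> 2 * t + 0 \<in> S" "t \<in> T' \<longleftrightarrow> 2 * t + - 1 \<in> T"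
      unfolding S'_def T'_def image_iff by simp_all
  qed
  have S': "C1_pieces A (\<gamma> +++ \<delta>) S'"
    by (rule C1_pieces_affine[OF S(4), of 2 _ 0 "1/2" 0]) (use S(3) mem in \<open>auto simp: joinpaths_def\<close>)
  have "(\<gamma> +++ \<delta>) t = \<delta> (2 * t + - 1)" if "t \<in> {1/2..1}" for t
    using joinpaths_second_half[OF assms(3)] that by simp
  then have T': "C1_pieces A (\<gamma> +++ \<delta>) T'"
    by (intro C1_pieces_affine[OF T(4), of 2 _ "1/2" 1 "- 1"]) (use T(3) mem in \<open>auto\<close>)
  have bounds: "S' \<subseteq> {0..1/2}" "T' \<subseteq> {1/2..1}"
    using S(3) T(3) by (auto simp: S'_def T'_def)
  have sep: "s \<in> S' \<Longrightarrow> s \<le> 1/2" "s \<in> T' \<Longrightarrow> 1/2 \<le> s" for s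
    using bounds by (meson atLeastAtMost_iff subsetD)+
  have half: "1/2 \<in> S'" "1/2 \<in> T'"
    using S(2) T(2) by (auto simp: mem)
  have "C1_pieces A (\<gamma> +++ \<delta>) (S' \<union> T')"
    unfolding C1_pieces_def
  proof (intro ballI impI, elim conjE)
    fix a b assume ab: "a \<in> S' \<union> T'" "b \<in> S' \<union> T'" "a < b" "{a<..<b} \<inter> (S' \<union> T') = {}"
    \<comment> \<open>The junction belongs to both break sets, so no gap of the union straddles
      it.\<close>
    then have "1/2 \<notin> {a<..<b}"
      using half by blast
    then consider "b \<le> 1/2" | "1/2 \<le> a" by force
    then show "C1_curve_on A (\<gamma> +++ \<delta>) a b"
    proof cases
      case 1
      have "b \<in> S'"
        using 1 ab(2) sep(2) half(1) by (metis Un_iff order_antisym)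
      moreover have "a \<in> S'"
        using 1 ab(1,3) sep(2)[of a] by auto
      ultimately show ?thesis using S' ab unfolding C1_pieces_def by blast
    next
      case 2
      have "a \<in> T'"
        using 2 ab(1) sep(1) half(2) by (metis Un_iff order_antisym)
      moreover have "b \<in> T'"
        using 2 ab(2,3) sep(1)[of b] by auto
      ultimately show ?thesis using T' ab unfolding C1_pieces_def by blast
    qed
  qed
  moreover have "finite (S' \<union> T')" "{0, 1} \<subseteq> S' \<union> T'" "S' \<union> T' \<subseteq> {0..1}"
    using S(1,2) T(1,2) bounds by (auto simp: S'_def T'_def)
  ultimately show ?thesis
    using \<gamma> \<delta> assms(3) unfolding piecewise_C1_path_def C1_pieces_def
    by (intro conjI exI[of _ "S' \<union> T'"]) (auto simp: path_image_join)
qed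

lemma curve_length_reversepath:
  assumes "piecewise_C1_path M A \<gamma>" and int: "speed A g \<gamma> integrable_on {0..1}"
    and chart: "\<And>p. p \<in> M \<Longrightarrow> chart_at A p \<in> A \<and> p \<in> fst (chart_at A p)"
  shows "curve_length A g (reversepath \<gamma>) = curve_length A g \<gamma>"
proof -
  obtain S where S: "finite S" "{0, 1} \<subseteq> S" "C1_pieces A \<gamma> S"
    using assms unfolding piecewise_C1_path_def C1_pieces_def by blast
  have "(\<lambda>t. - 1 * t + 1) ` {0..1} = {0..1::real}"
    unfolding image_affinity_atLeastAtMost by auto
  then have "(speed A g (reversepath \<gamma>) has_integral curve_length A g \<gamma>) {0..1}"
  proof (rule has_integral_speed_affine[OF S(3,1,2), rotated])
    fix t :: real assume "t \<in> {0..1}"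
    then have "\<gamma> t \<in> M"
      using assms(1) by (auto simp: piecewise_C1_path_def path_image_def)
    then show "chart_at A (\<gamma> t) \<in> A \<and> \<gamma> t \<in> fst (chart_at A (\<gamma> t))"
      by (rule chart)
  qed (use int in \<open>auto simp: reversepath_def\<close>)
  then show ?thesis
    unfolding curve_length_def[of A g "reversepath \<gamma>"] by (rule integral_unique)
qed

lemma curve_length_joinpaths:
  assumes \<gamma>: "piecewise_C1_path M A \<gamma>" "speed A g \<gamma> integrable_on {0..1}"
    and \<delta>: "piecewise_C1_path M A \<delta>" "speed A g \<delta> integrable_on {0..1}"
    and join: "pathfinish \<gamma> = pathstart \<delta>"
    and chart: "\<And>p. p \<in> M \<Longrightarrow> chart_at A p \<in> A \<and> p \<in> fst (chart_at A p)"
  shows "curve_length A g (\<gamma> +++ \<delta>) = curve_length A g \<gamma> + curve_length A g \<delta>"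
proof -
  obtain S where S: "finite S" "{0, 1} \<subseteq> S" "C1_pieces A \<gamma> S"
    using \<gamma> unfolding piecewise_C1_path_def C1_pieces_def by blast
  obtain T where T: "finite T" "{0, 1} \<subseteq> T" "C1_pieces A \<delta> T"
    using \<delta> unfolding piecewise_C1_path_def C1_pieces_def by blast
  have I1: "(\<lambda>t. 2 * t + 0) ` {0..1/2} = {0..1::real}" and I2: "(\<lambda>t. 2 * t + - 1) ` {1/2..1} = {0..1::real}"
    unfolding image_affinity_atLeastAtMost by auto
  have J: "(\<gamma> +++ \<delta>) t = \<delta> (2 * t + - 1)" if "t \<in> {1/2..1}" for t
    using joinpaths_second_half[OF join] that by simp
  have chart_\<gamma>: "chart_at A (\<gamma> t) \<in> A \<and> \<gamma> t \<in> fst (chart_at A (\<gamma> t))"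
    and chart_\<delta>: "chart_at A (\<delta> t) \<in> A \<and> \<delta> t \<in> fst (chart_at A (\<delta> t))" if "t \<in> {0..1}" for t
  proof -
    have "\<gamma> t \<in> M" "\<delta> t \<in> M"
      using \<gamma>(1) \<delta>(1) that by (auto simp: piecewise_C1_path_def path_image_def)
    then show "chart_at A (\<gamma> t) \<in> A \<and> \<gamma> t \<in> fst (chart_at A (\<gamma> t))"
      "chart_at A (\<delta> t) \<in> A \<and> \<delta> t \<in> fst (chart_at A (\<delta> t))"
      by (auto dest: chart)
  qed
  have "(speed A g (\<gamma> +++ \<delta>) has_integral curve_length A g \<gamma>) {0..1/2}"
    by (rule has_integral_speed_affine[OF S(3,1,2) _ I1 _ \<gamma>(2) chart_\<gamma>]) (auto simp: joinpaths_def)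
  moreover have "(speed A g (\<gamma> +++ \<delta>) has_integral curve_length A g \<delta>) {1/2..1}"
    by (rule has_integral_speed_affine[OF T(3,1,2) _ I2 J \<delta>(2) chart_\<delta>]) auto
  ultimately have "(speed A g (\<gamma> +++ \<delta>) has_integral curve_length A g \<gamma> + curve_length A g \<delta>) {0..1}"
    by (rule has_integral_combine[rotated 2]) auto
  then show ?thesis
    unfolding curve_length_def[of A g "\<gamma> +++ \<delta>"] by (rule integral_unique)
qed

section \<open>Lengths of curves\<close>

definition covering_derivative :: "real^(2 + 'k::finite) \<Rightarrow> real^(2 + 'k) \<Rightarrow> (real^2) \<times> (complex^'k)" where
  "covering_derivative x h = (planar h, \<chi> j. h $ Inr j *\<^sub>R (\<i> * cis (x $ Inr j)))"

lemma has_derivative_covering: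
  fixes x :: "real^(2 + 'k::finite)"
  shows
  "(plane_torus_covering has_derivative covering_derivative x) (at x within S)"
proof -
  have "((\<lambda>x. \<chi> j. cis (x $ Inr j)) has_derivative (\<lambda>h. \<chi> j. h $ Inr j *\<^sub>R (\<i> * cis (x $ Inr j)))) (at x within S)"
    unfolding has_derivative_componentwise_within[of "\<lambda>x. \<chi> j. cis (x $ Inr j)"]
  proof
    fix b :: "complex^'k" assume "b \<in> Basis"
    then obtain j u where b: "b = axis j u"
      by (auto simp: Basis_vec_def)
    have "((\<lambda>x. cis (x $ Inr j) \<bullet> u) has_derivative (\<lambda>h. (h $ Inr j *\<^sub>R (\<i> * cis (x $ Inr j))) \<bullet> u)) (at x within S)"
      by (intro has_derivative_inner_left has_derivative_cis bounded_linear_imp_has_derivative bounded_linear_vec_nth)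
    then show "((\<lambda>x. (\<chi> j. cis (x $ Inr j)) \<bullet> b) has_derivative
        (\<lambda>h. (\<chi> j. h $ Inr j *\<^sub>R (\<i> * cis (x $ Inr j))) \<bullet> b)) (at x within S)"
      by (simp add: b inner_axis)
  qed
  moreover have "(planar has_derivative planar) (at x within S)"
    by (rule bounded_linear_imp_has_derivative[OF bounded_linear_planar])
  ultimately have "((\<lambda>x. (planar x, \<chi> j. cis (x $ Inr j))) has_derivative covering_derivative x) (at x within S)"
    unfolding covering_derivative_def by (rule has_derivative_Pair[rotated])
  then show ?thesis
    by (simp add: plane_torus_covering_def[abs_def] planar_def[abs_def])
qed

text \<open>Each factor i cis \<phi> has modulus 1, so the covering is isometric on the torus factor
  with its flat metric.\<close>

lemma norm_snd_covering_derivative: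
  "(norm (snd (covering_derivative x h)))\<^sup>2 = (\<Sum>j\<in>UNIV. (h $ Inr j)\<^sup>2)"
  by (simp add: covering_derivative_def norm_vec_def L2_set_def sum_nonneg norm_mult)

text \<open>The Riemannian norm written without charts, for a vector \<open>w\<close> of the ambient
  space at \<open>p\<close>. Being defined for all ambient vectors, not only tangent ones, it can be
  compared directly with derivatives of functions on the ambient space.\<close>

definition flat_speed :: "real \<Rightarrow> (real^2) \<times> (complex^'k::finite) \<Rightarrow> (real^2) \<times> (complex^'k) \<Rightarrow> real" where
  "flat_speed \<alpha> p w = ell (fst p) powr \<alpha> * sqrt ((norm (fst w))\<^sup>2 / quad (fst p) + (norm (snd w))\<^sup>2)"

lemma flat_speed_covering:
  "flat_speed \<alpha> (plane_torus_covering x) (covering_derivative x v) = sqrt (v \<bullet> (plane_torus_metric \<alpha> x *v v))"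
proof -
  have "ell (planar x) powr (2 * \<alpha>) = (ell (planar x) powr \<alpha>)\<^sup>2"
    by (simp add: power2_eq_square flip: powr_add)
  then show ?thesis
    unfolding plane_torus_metric_quadratic_form flat_speed_def norm_snd_covering_derivative
    by (simp add: real_sqrt_mult covering_derivative_def)
qed

lemma continuous_on_quad [continuous_intros]:
  "continuous_on S f \<Longrightarrow> continuous_on S (\<lambda>x. quad (f x))"
  unfolding quad_def by (intro continuous_intros)

lemma continuous_on_ell [continuous_intros]:
  "continuous_on S f \<Longrightarrow> continuous_on S (\<lambda>x. ell (f x))"
  unfolding ell_def by (intro continuous_intros) simp_all

text \<open>Passes from chart derivatives to one ambient velocity, continuous up to the endpoints.
  Near each time the curve is the covering applied to its coordinate expression, so the chain rule
  applies.\<close>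

lemma C1_curve_plane_torus:
  fixes \<gamma> :: "real \<Rightarrow> (real^2) \<times> (complex^'k::finite)"
  assumes C1: "C1_curve_on plane_torus_atlas \<gamma> a b" and "a < b"
    and cont: "continuous_on {a..b} \<gamma>" and M: "\<gamma> ` {a..b} \<subseteq> plane_times_torus"
  obtains \<gamma>' where "continuous_on {a..b} \<gamma>'"
    "\<And>t. t \<in> {a..b} \<Longrightarrow> (\<gamma> has_vector_derivative \<gamma>' t) (at t within {a..b})"
    "\<And>t. t \<in> {a<..<b} \<Longrightarrow>
       speed plane_torus_atlas (\<lambda>c. plane_torus_metric \<alpha>) \<gamma> t = flat_speed \<alpha> (\<gamma> t) (\<gamma>' t)"
proof -
  \<comment> \<open>A canonical choice of velocity, so that the formulas found in different charts
    agree automatically.\<close>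
  define \<gamma>' where "\<gamma>' t = vector_derivative \<gamma> (at t within {a..b})" for t
  have local: "continuous (at t within {a..b}) \<gamma>' \<and> (\<gamma> has_vector_derivative \<gamma>' t) (at t within {a..b}) \<and>
      (t \<in> {a<..<b} \<longrightarrow> speed plane_torus_atlas (\<lambda>c. plane_torus_metric \<alpha>) \<gamma> t = flat_speed \<alpha> (\<gamma> t) (\<gamma>' t))"
    if t: "t \<in> {a..b}" for t
  proof -
    define c where "c = chart_at plane_torus_atlas (\<gamma> t)"
    define T where "T = {s \<in> {a..b}. \<gamma> s \<in> fst c}"
    have "\<gamma> t \<in> plane_times_torus"
      using M t by auto
    then have c: "c \<in> plane_torus_atlas" "\<gamma> t \<in> fst c"
      unfolding c_def by (rule chart_at_plane_torus)+
    then have "t \<in> T"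
      using t by (simp add: T_def)
    have "openin (top_of_set plane_times_torus) (fst c)"
      using smooth_atlas_plane_torus_atlas c(1) unfolding smooth_atlas_def by blast
    then have "openin (top_of_set {a..b}) ({a..b} \<inter> \<gamma> -` fst c)"
      using M by (intro continuous_openin_preimage[OF cont]) auto
    moreover have "{a..b} \<inter> \<gamma> -` fst c = T"
      by (auto simp: T_def)
    ultimately obtain U where U: "open U" "T = {a..b} \<inter> U"
      unfolding openin_open by auto
    \<comment> \<open>\<open>T\<close> is relatively open in the interval, so derivatives within
      either set coincide.\<close>
    have tT: "at s within {a..b} = at s within T" if "s \<in> T" for s
      using that U by (intro at_within_nhd[of s U]) auto
    define \<phi> where "\<phi> = snd c \<circ> \<gamma>"
    obtain v where v: "continuous_on T v" "\<forall>s\<in>T. (\<phi> has_vector_derivative v s) (at s within {a..b})"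
      using C1 c(1) unfolding C1_curve_on_def Let_def T_def \<phi>_def by blast
    have lift: "plane_torus_covering (\<phi> s) = \<gamma> s" if "s \<in> T" for s
      using chart_covering[OF c(1)] that by (simp add: \<phi>_def T_def)
    have deriv: "(\<gamma> has_vector_derivative covering_derivative (\<phi> s) (v s)) (at s within T)" if "s \<in> T" for s
    proof -
      have "(\<phi> has_derivative (\<lambda>h. h *\<^sub>R v s)) (at s within T)"
        using bspec[OF v(2) that] unfolding tT[OF that] has_vector_derivative_def .
      then have "(plane_torus_covering \<circ> \<phi> has_derivative covering_derivative (\<phi> s) \<circ> (\<lambda>h. h *\<^sub>R v s)) (at s within T)"
        by (rule diff_chain_within[OF _ has_derivative_covering])
      moreover have "covering_derivative (\<phi> s) \<circ> (\<lambda>h. h *\<^sub>R v s) = (\<lambda>h. h *\<^sub>R covering_derivative (\<phi> s) (v s))"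
        using has_derivative_linear[OF has_derivative_covering[of "\<phi> s" UNIV]]
        by (simp add: fun_eq_iff linear_cmul)
      ultimately have "(plane_torus_covering \<circ> \<phi> has_vector_derivative covering_derivative (\<phi> s) (v s)) (at s within T)"
        by (simp add: has_vector_derivative_def)
      then show ?thesis
        by (rule has_vector_derivative_transform[rotated 2]) (use that in \<open>simp_all add: lift\<close>)
    qed
    have \<gamma>': "\<gamma>' s = covering_derivative (\<phi> s) (v s)" if "s \<in> T" for s
      unfolding \<gamma>'_def
      by (rule vector_derivative_within_closed_interval[OF \<open>a < b\<close>])
        (use that U deriv[OF that] tT[OF that] in simp_all)
    have "continuous_on T \<phi>"
      unfolding continuous_on_eq_continuous_within
      using v(2) tT by (auto intro: has_vector_derivative_continuous)
    then have "continuous_on T (\<lambda>s. covering_derivative (\<phi> s) (v s))"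
      unfolding covering_derivative_def using v(1)
      by (intro continuous_intros bounded_linear.continuous_on[OF bounded_linear_planar])
    then have "continuous_on T \<gamma>'"
      using \<gamma>' continuous_on_cong by fastforce
    then have "continuous (at t within T) \<gamma>'"
      using \<open>t \<in> T\<close> by (simp add: continuous_on_eq_continuous_within)
    moreover have "(\<gamma> has_vector_derivative \<gamma>' t) (at t within T)"
      using deriv[OF \<open>t \<in> T\<close>] by (simp add: \<gamma>'[OF \<open>t \<in> T\<close>])
    moreover have "speed plane_torus_atlas (\<lambda>c. plane_torus_metric \<alpha>) \<gamma> t = flat_speed \<alpha> (\<gamma> t) (\<gamma>' t)"
      if "t \<in> {a<..<b}"
    proof -
      have "(\<phi> has_vector_derivative v t) (at t)"
        using bspec[OF v(2) \<open>t \<in> T\<close>] that by (simp add: at_within_Icc_at)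
      then have "vector_derivative \<phi> (at t) = v t"
        by (rule vector_derivative_at)
      then have "speed plane_torus_atlas (\<lambda>c. plane_torus_metric \<alpha>) \<gamma> t =
          sqrt (v t \<bullet> (plane_torus_metric \<alpha> (\<phi> t) *v v t))"
        by (simp add: speed_def Let_def \<phi>_def c_def)
      also have "\<dots> = flat_speed \<alpha> (\<gamma> t) (\<gamma>' t)"
        unfolding flat_speed_covering[symmetric] lift[OF \<open>t \<in> T\<close>] \<gamma>'[OF \<open>t \<in> T\<close>] ..
      finally show ?thesis .
    qed
    ultimately show ?thesis
      by (simp add: tT[OF \<open>t \<in> T\<close>])
  qed
  show ?thesis
    by (rule that[of \<gamma>']) (use local in \<open>auto simp: continuous_on_eq_continuous_within\<close>)
qed

text \<open>Fundamental theorem of calculus for \<Phi> along the curve, with the integrand bounded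
  by the speed. The speed agrees with a continuous function except possibly at the two endpoints,
  whence its integrability.\<close>

lemma C1_curve_lipschitz:
  fixes \<gamma> :: "real \<Rightarrow> (real^2) \<times> (complex^'k::finite)" and \<Phi> :: "(real^2) \<times> (complex^'k) \<Rightarrow> 'e::banach" and \<alpha> :: real
  defines "L \<equiv> speed plane_torus_atlas (\<lambda>c. plane_torus_metric \<alpha>)"
  assumes C1: "C1_curve_on plane_torus_atlas \<gamma> a b" and "a < b"
    and cont: "continuous_on {a..b} \<gamma>" and M: "\<gamma> ` {a..b} \<subseteq> plane_times_torus"
    and \<Phi>: "\<And>p. (\<Phi> has_derivative \<Phi>' p) (at p)" "\<And>p w. norm (\<Phi>' p w) \<le> flat_speed \<alpha> p w"
  shows "L \<gamma> integrable_on {a..b}" "norm (\<Phi> (\<gamma> b) - \<Phi> (\<gamma> a)) \<le> integral {a..b} (L \<gamma>)"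
proof -
  obtain \<gamma>' where \<gamma>': "continuous_on {a..b} \<gamma>'"
    "\<And>t. t \<in> {a..b} \<Longrightarrow> (\<gamma> has_vector_derivative \<gamma>' t) (at t within {a..b})"
    "\<And>t. t \<in> {a<..<b} \<Longrightarrow> L \<gamma> t = flat_speed \<alpha> (\<gamma> t) (\<gamma>' t)"
    unfolding L_def by (rule C1_curve_plane_torus[OF C1 \<open>a < b\<close> cont M]) blast
  let ?f = "\<lambda>t. flat_speed \<alpha> (\<gamma> t) (\<gamma>' t)"
  have "continuous_on {a..b} ?f"
    unfolding flat_speed_def
    by (intro continuous_intros cont \<gamma>'(1)) simp_all
  then have f: "?f integrable_on {a..b}"
    by (rule integrable_continuous_interval)
  have *: "(L \<gamma> has_integral integral {a..b} ?f) {a..b}"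
  proof (rule has_integral_spike_finite)
    show "L \<gamma> t = ?f t" if "t \<in> {a..b} - {a, b}" for t
      using that by (intro \<gamma>'(3)) auto
  qed (use f integrable_integral in auto)
  then show "L \<gamma> integrable_on {a..b}"
    by (rule has_integral_integrable)
  have "((\<lambda>t. \<Phi>' (\<gamma> t) (\<gamma>' t)) has_integral (\<Phi> \<circ> \<gamma>) b - (\<Phi> \<circ> \<gamma>) a) {a..b}"
  proof (rule fundamental_theorem_of_calculus)
    fix t assume t: "t \<in> {a..b}"
    have "(\<Phi> \<circ> \<gamma> has_derivative \<Phi>' (\<gamma> t) \<circ> (\<lambda>h. h *\<^sub>R \<gamma>' t)) (at t within {a..b})"
      using \<gamma>'(2)[OF t] unfolding has_vector_derivative_def
      by (rule diff_chain_within) (rule has_derivative_at_withinI[OF \<Phi>(1)])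
    moreover have "\<Phi>' (\<gamma> t) \<circ> (\<lambda>h. h *\<^sub>R \<gamma>' t) = (\<lambda>h. h *\<^sub>R \<Phi>' (\<gamma> t) (\<gamma>' t))"
      using has_derivative_linear[OF \<Phi>(1)] by (simp add: fun_eq_iff linear_cmul)
    ultimately show "(\<Phi> \<circ> \<gamma> has_vector_derivative \<Phi>' (\<gamma> t) (\<gamma>' t)) (at t within {a..b})"
      by (simp add: has_vector_derivative_def)
  qed (use \<open>a < b\<close> in simp)
  then have "(\<lambda>t. \<Phi>' (\<gamma> t) (\<gamma>' t)) integrable_on {a..b}"
    and I: "integral {a..b} (\<lambda>t. \<Phi>' (\<gamma> t) (\<gamma>' t)) = \<Phi> (\<gamma> b) - \<Phi> (\<gamma> a)"
    by (simp_all only: has_integral_integrable integral_unique o_def)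
  then have "norm (integral {a..b} (\<lambda>t. \<Phi>' (\<gamma> t) (\<gamma>' t))) \<le> integral {a..b} ?f"
    using f \<Phi>(2) by (intro Henstock_Kurzweil_Integration.integral_norm_bound_integral)
  then show "norm (\<Phi> (\<gamma> b) - \<Phi> (\<gamma> a)) \<le> integral {a..b} (L \<gamma>)"
    unfolding I integral_unique[OF *] .
qed

text \<open>Telescoping over the gaps, by induction on the number of break points below
  \<open>b\<close>: the largest of them, \<open>a\<close>, carries the induction hypothesis and the
  last gap adds one piece.\<close>

lemma integral_bound_pieces:
  fixes h :: "real \<Rightarrow> 'e::real_normed_vector" and f :: "real \<Rightarrow> real"
  assumes S: "finite S" "0 \<in> S" "S \<subseteq> {0..1}" and "b \<in> S"
    and piece: "\<And>a b. a \<in> S \<Longrightarrow> b \<in> S \<Longrightarrow> a < b \<Longrightarrow> {a<..<b} \<inter> S = {} \<Longrightarrow>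
      f integrable_on {a..b} \<and> norm (h b - h a) \<le> integral {a..b} f"
  shows "f integrable_on {0..b} \<and> norm (h b - h 0) \<le> integral {0..b} f"
  using \<open>b \<in> S\<close>
proof (induction "card {s \<in> S. s < b}" arbitrary: b rule: less_induct)
  case less
  show ?case
  proof (cases "b = 0")
    case True
    then show ?thesis
      using integrable_on_refl[of f 0] integral_refl[of 0 f] by simp
  next
    case False
    let ?L = "{s \<in> S. s < b}"
    have "0 \<in> ?L"
      using False S(2,3) less.prems by auto
    then have L: "finite ?L" "?L \<noteq> {}"
      using S(1) by (simp, blast)
    define a where "a = Max ?L"
    have a: "a \<in> S" "a < b"
      using Max_in[OF L] by (simp_all add: a_def)
    have gap: "s \<le> a" if "s \<in> S" "s < b" for s
      using Max_ge[OF L(1)] that by (simp add: a_def)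
    then have "{a<..<b} \<inter> S = {}"
      by force
    with a less.prems have ab: "f integrable_on {a..b}" "norm (h b - h a) \<le> integral {a..b} f"
      using piece by blast+
    have "{s \<in> S. s < a} \<subset> ?L"
      using a by auto
    then have "card {s \<in> S. s < a} < card ?L"
      by (rule psubset_card_mono[OF L(1)])
    from less.hyps[OF this \<open>a \<in> S\<close>] have IH: "f integrable_on {0..a}" "norm (h a - h 0) \<le> integral {0..a} f"
      by auto
    have "0 \<le> a"
      using a S(3) by auto
    have int: "f integrable_on {0..b}"
      using \<open>0 \<le> a\<close> \<open>a < b\<close> IH ab by (intro Henstock_Kurzweil_Integration.integrable_combine[of 0 a b]) auto
    have "norm (h b - h 0) \<le> norm (h a - h 0) + norm (h b - h a)"
      using norm_triangle_ineq[of "h a - h 0" "h b - h a"] by simp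
    also have "\<dots> \<le> integral {0..a} f + integral {a..b} f"
      using IH ab by (intro add_mono)
    also have "\<dots> = integral {0..b} f"
      using \<open>0 \<le> a\<close> \<open>a < b\<close> int by (intro Henstock_Kurzweil_Integration.integral_combine) auto
    finally show ?thesis
      using int by blast
  qed
qed

text \<open>The source of all lower bounds on lengths, and hence on distances.\<close>

lemma path_lipschitz:
  fixes \<gamma> :: "real \<Rightarrow> (real^2) \<times> (complex^'k::finite)" and \<Phi> :: "(real^2) \<times> (complex^'k) \<Rightarrow> 'e::banach" and \<alpha> :: real
  defines "g \<equiv> (\<lambda>c :: ((real^2) \<times> (complex^'k), 2 + 'k) chart. plane_torus_metric \<alpha> :: real^(2 + 'k) \<Rightarrow> _)"
  assumes \<gamma>: "piecewise_C1_path plane_times_torus plane_torus_atlas \<gamma>"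
    and \<Phi>: "\<And>p. (\<Phi> has_derivative \<Phi>' p) (at p)" "\<And>p w. norm (\<Phi>' p w) \<le> flat_speed \<alpha> p w"
  shows "speed plane_torus_atlas g \<gamma> integrable_on {0..1}"
    "norm (\<Phi> (pathfinish \<gamma>) - \<Phi> (pathstart \<gamma>)) \<le> curve_length plane_torus_atlas g \<gamma>"
proof -
  obtain S where S: "finite S" "{0, 1} \<subseteq> S" "S \<subseteq> {0..1}" "C1_pieces plane_torus_atlas \<gamma> S"
    using \<gamma> unfolding piecewise_C1_path_def C1_pieces_def by blast
  have cont: "continuous_on {0..1} \<gamma>" and M: "\<gamma> ` {0..1} \<subseteq> plane_times_torus"
    using \<gamma> by (simp_all add: piecewise_C1_path_def path_def path_image_def)
  have "speed plane_torus_atlas g \<gamma> integrable_on {0..1} \<and>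
     norm ((\<Phi> \<circ> \<gamma>) 1 - (\<Phi> \<circ> \<gamma>) 0) \<le> integral {0..1} (speed plane_torus_atlas g \<gamma>)"
  proof (rule integral_bound_pieces[OF S(1) _ S(3)])
    fix a b assume ab: "a \<in> S" "b \<in> S" "a < b" "{a<..<b} \<inter> S = {}"
    then have C1: "C1_curve_on plane_torus_atlas \<gamma> a b" and sub: "{a..b} \<subseteq> {0..1}"
      using S(3,4) by (auto simp: C1_pieces_def)
    have "\<gamma> ` {a..b} \<subseteq> plane_times_torus"
      using M sub by blast
    from C1_curve_lipschitz[OF C1 \<open>a < b\<close> continuous_on_subset[OF cont sub] this \<Phi>]
    show "speed plane_torus_atlas g \<gamma> integrable_on {a..b} \<and>
       norm ((\<Phi> \<circ> \<gamma>) b - (\<Phi> \<circ> \<gamma>) a) \<le> integral {a..b} (speed plane_torus_atlas g \<gamma>)"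
      by (simp add: g_def)
  qed (use S(2) in auto)
  then show "speed plane_torus_atlas g \<gamma> integrable_on {0..1}"
    "norm (\<Phi> (pathfinish \<gamma>) - \<Phi> (pathstart \<gamma>)) \<le> curve_length plane_torus_atlas g \<gamma>"
    by (simp_all add: pathstart_def pathfinish_def curve_length_def)
qed

lemma flat_speed_nonneg: "0 \<le> flat_speed \<alpha> p w"
  by (simp add: flat_speed_def less_imp_le)

lemma path_integrable:
  fixes \<gamma> :: "real \<Rightarrow> (real^2) \<times> (complex^'k::finite)"
  assumes "piecewise_C1_path plane_times_torus plane_torus_atlas \<gamma>"
  shows "speed plane_torus_atlas (\<lambda>c. plane_torus_metric \<alpha>) \<gamma> integrable_on {0..1}"
    "0 \<le> curve_length plane_torus_atlas (\<lambda>c. plane_torus_metric \<alpha>) \<gamma>"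
proof -
  \<comment> \<open>The zero function is admissible; it already yields integrability and nonnegative
    length.\<close>
  have \<Phi>: "((\<lambda>p. 0::real) has_derivative (\<lambda>w. 0)) (at p)" "norm (0::real) \<le> flat_speed \<alpha> p w"
    for p w :: "(real^2) \<times> (complex^'k)"
    by (simp_all add: flat_speed_nonneg)
  show "speed plane_torus_atlas (\<lambda>c. plane_torus_metric \<alpha>) \<gamma> integrable_on {0..1}"
    by (rule path_lipschitz(1)[OF assms \<Phi>])
  show "0 \<le> curve_length plane_torus_atlas (\<lambda>c. plane_torus_metric \<alpha>) \<gamma>"
    using path_lipschitz(2)[OF assms \<Phi>] by simp
qed

section \<open>The distance function\<close>

lemma segment_chart_has_vector_derivative:
  fixes x y :: "real^(2 + 'k::finite)"
  defines "\<gamma> \<equiv> \<lambda>t. plane_torus_covering (x + t *\<^sub>R (y - x))"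
  assumes "c \<in> plane_torus_atlas" "\<gamma> t \<in> fst c"
  shows "(snd c \<circ> \<gamma> has_vector_derivative y - x) (at t)"
proof -
  obtain b where b: "c = plane_torus_chart b"
    using assms(2) by (auto simp: plane_torus_atlas_def)
  let ?X = "\<lambda>t. x + t *\<^sub>R (y - x)"
  \<comment> \<open>Subtracting pi centres the angle box, of width 2 pi, at the current point of the
    segment. Any other chart then differs from this one by a local translation, which keeps the
    velocity \<open>y - x\<close>.\<close>
  define a :: "real^'k" where "a = (\<chi> j. ?X t $ Inr j - pi)"
  have "?X t \<in> angle_box a"
    by (simp add: angle_box_def a_def)
  moreover have "plane_torus_covering (?X t) \<in> plane_torus_covering ` angle_box b"
    using assms(3) by (simp add: b fst_plane_torus_chart \<gamma>_def)
  ultimately obtain d T where T: "open T" "?X t \<in> T" "T \<subseteq> angle_box a"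
    "\<And>z. z \<in> T \<Longrightarrow> transition (plane_torus_chart a) c z = z + d"
    unfolding b by (rule transition_plane_torus_chart) blast
  have inv: "inv_into (plane_torus_covering ` angle_box a) (inv_into (angle_box a) plane_torus_covering) z =
      plane_torus_covering z" if "z \<in> angle_box a" for z
    by (rule inv_into_f_eq)
      (use that in \<open>auto intro!: inj_on_inv_into simp: inj_on_angle_box inv_into_f_f\<close>)
  have eq: "(snd c \<circ> \<gamma>) s = ?X s + d" if "s \<in> ?X -` T" for s
  proof -
    have s: "?X s \<in> T" "?X s \<in> angle_box a"
      using that T(3) by auto
    have "transition (plane_torus_chart a) c (?X s) = (snd c \<circ> \<gamma>) s"
      by (simp only: transition_def fst_plane_torus_chart snd_plane_torus_chart o_apply inv[OF s(2)] \<gamma>_def)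
    with T(4)[OF s(1)] show ?thesis
      by simp
  qed
  have "open (?X -` T)"
    by (intro open_vimage T(1) continuous_intros)
  moreover have "((\<lambda>s. ?X s + d) has_vector_derivative y - x) (at t)"
    by (auto intro!: derivative_eq_intros)
  ultimately show ?thesis
    using T(2) by (intro has_vector_derivative_transform_within_open[where S = "?X -` T", OF _ _ _ eq[symmetric]]) simp_all
qed

lemma piecewise_C1_path_segment:
  fixes x y :: "real^(2 + 'k::finite)"
  defines "\<gamma> \<equiv> \<lambda>t. plane_torus_covering (x + t *\<^sub>R (y - x))"
  shows "piecewise_C1_path plane_times_torus plane_torus_atlas \<gamma>"
proof -
  have "C1_curve_on plane_torus_atlas \<gamma> 0 1"
    unfolding C1_curve_on_def Let_def
  proof
    fix c :: "((real^2) \<times> (complex^'k), 2 + 'k) chart" assume "c \<in> plane_torus_atlas"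
    then show "\<exists>v. continuous_on {t \<in> {0..1}. \<gamma> t \<in> fst c} v \<and>
        (\<forall>t\<in>{t \<in> {0..1}. \<gamma> t \<in> fst c}. (snd c \<circ> \<gamma> has_vector_derivative v t) (at t within {0..1}))"
      unfolding \<gamma>_def
      by (intro exI[of _ "\<lambda>t. y - x"] conjI ballI)
        (simp_all add: has_vector_derivative_at_within[OF segment_chart_has_vector_derivative])
  qed
  then have "\<forall>a\<in>{0, 1}. \<forall>b\<in>{0, 1}. a < b \<and> {a<..<b} \<inter> {0, 1} = {} \<longrightarrow> C1_curve_on plane_torus_atlas \<gamma> a b"
    by auto
  moreover have "path \<gamma>"
    unfolding path_def \<gamma>_def
    by (intro continuous_on_compose2[OF continuous_plane_torus_covering[of UNIV]] continuous_intros) auto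
  moreover have "path_image \<gamma> \<subseteq> plane_times_torus"
    by (auto simp: path_image_def \<gamma>_def plane_torus_covering_in)
  ultimately show ?thesis
    unfolding piecewise_C1_path_def by (intro conjI exI[of _ "{0, 1}"]) auto
qed

text \<open>A crude bound, used only for short segments: drop the denominator \<open>quad\<close>,
  which is at least 1, and bound the conformal factor by \<open>B\<close>.\<close>

lemma curve_length_segment_le:
  fixes x y :: "real^(2 + 'k::finite)"
  defines "\<gamma> \<equiv> \<lambda>t. plane_torus_covering (x + t *\<^sub>R (y - x))"
  assumes \<alpha>: "0 \<le> \<alpha>" "\<alpha> \<le> 1"
    and B: "\<And>t. t \<in> {0..1} \<Longrightarrow> ell (planar (x + t *\<^sub>R (y - x))) \<le> B"
  shows "curve_length plane_torus_atlas (\<lambda>c. plane_torus_metric \<alpha>) \<gamma> \<le> B * norm (y - x)"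
proof -
  let ?v = "y - x"
  have speed: "speed plane_torus_atlas (\<lambda>c. plane_torus_metric \<alpha>) \<gamma> t \<le> B * norm ?v" if t: "t \<in> {0..1}" for t
  proof -
    define c where "c = chart_at plane_torus_atlas (\<gamma> t)"
    have c: "c \<in> plane_torus_atlas" "\<gamma> t \<in> fst c"
      unfolding c_def \<gamma>_def by (rule chart_at_plane_torus plane_torus_covering_in)+
    then have "vector_derivative (snd c \<circ> \<gamma>) (at t) = ?v"
      unfolding \<gamma>_def by (intro vector_derivative_at segment_chart_has_vector_derivative)
    then have sp: "speed plane_torus_atlas (\<lambda>c. plane_torus_metric \<alpha>) \<gamma> t =
        sqrt (?v \<bullet> (plane_torus_metric \<alpha> (snd c (\<gamma> t)) *v ?v))"
      by (simp add: speed_def Let_def c_def)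
    have "plane_torus_covering (snd c (\<gamma> t)) = plane_torus_covering (x + t *\<^sub>R ?v)"
      using chart_covering[OF c] by (simp add: \<gamma>_def)
    then have pl: "planar (snd c (\<gamma> t)) = planar (x + t *\<^sub>R ?v)"
      using fst_plane_torus_covering by metis
    define l where "l = ell (planar (x + t *\<^sub>R ?v))"
    have l: "1 \<le> l" "l \<le> B"
      using ell_ge_2[of "planar (x + t *\<^sub>R ?v)"] B[OF t] by (simp_all add: l_def)
    have "(norm (planar ?v))\<^sup>2 / quad (planar (x + t *\<^sub>R ?v)) \<le> (norm (planar ?v))\<^sup>2 / 1"
      using quad_ge_1 by (intro divide_left_mono) auto
    moreover have "(norm ?v)\<^sup>2 = (norm (planar ?v))\<^sup>2 + (\<Sum>j\<in>UNIV. (?v $ Inr j)\<^sup>2)"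
      unfolding dot_square_norm[symmetric] inner_vec_def sum_UNIV_Plus
      by (simp add: planar_def power2_eq_square)
    ultimately have "?v \<bullet> (plane_torus_metric \<alpha> (snd c (\<gamma> t)) *v ?v) \<le> l powr (2 * \<alpha>) * (norm ?v)\<^sup>2"
      unfolding plane_torus_metric_quadratic_form pl l_def by (intro mult_left_mono) simp_all
    also have "\<dots> = (l powr \<alpha> * norm ?v)\<^sup>2"
      by (simp add: power_mult_distrib power2_eq_square flip: powr_add)
    finally have "speed plane_torus_atlas (\<lambda>c. plane_torus_metric \<alpha>) \<gamma> t \<le> l powr \<alpha> * norm ?v"
      unfolding sp by (rule real_le_lsqrt[rotated]) simp
    \<comment> \<open>Uses that \<alpha> is at most 1 and \<open>l\<close> at least 1.\<close>
    also have "l powr \<alpha> \<le> l powr 1"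
      using l \<alpha> by (intro powr_mono) auto
    then have "l powr \<alpha> * norm ?v \<le> B * norm ?v"
      using l by (intro mult_right_mono) auto
    finally show ?thesis .
  qed
  have int: "speed plane_torus_atlas (\<lambda>c. plane_torus_metric \<alpha>) \<gamma> integrable_on {0..1}"
    unfolding \<gamma>_def by (rule path_integrable(1)[OF piecewise_C1_path_segment])
  have "curve_length plane_torus_atlas (\<lambda>c. plane_torus_metric \<alpha>) \<gamma> \<le> integral {0..1} (\<lambda>t::real. B * norm ?v)"
    unfolding curve_length_def by (rule integral_le[OF int integrable_const_ivl speed])
  then show ?thesis
    by simp
qed

lemma plane_torus_covering_surj:
  assumes "p \<in> plane_times_torus"
  obtains x where "plane_torus_covering x = p"
  using chart_covering chart_at_plane_torus[OF assms] by blast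

definition plane_torus_paths ::
    "(real^2) \<times> (complex^'k::finite) \<Rightarrow> (real^2) \<times> (complex^'k) \<Rightarrow> (real \<Rightarrow> (real^2) \<times> (complex^'k)) set" where
  "plane_torus_paths p q =
     {\<gamma>. piecewise_C1_path plane_times_torus plane_torus_atlas \<gamma> \<and> pathstart \<gamma> = p \<and> pathfinish \<gamma> = q}"

lemma segment_in_paths:
  "(\<lambda>t. plane_torus_covering (x + t *\<^sub>R (y - x))) \<in> plane_torus_paths (plane_torus_covering x) (plane_torus_covering y)"
  by (simp add: plane_torus_paths_def piecewise_C1_path_segment pathstart_def pathfinish_def)

lemma plane_torus_paths_nonempty:
  assumes "p \<in> plane_times_torus" "q \<in> plane_times_torus"
  shows "plane_torus_paths p q \<noteq> {}"
  using assms segment_in_paths by (metis empty_iff plane_torus_covering_surj)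

definition plane_torus_length :: "real \<Rightarrow> (real \<Rightarrow> (real^2) \<times> (complex^'k::finite)) \<Rightarrow> real" where
  "plane_torus_length \<alpha> = curve_length plane_torus_atlas (\<lambda>c. plane_torus_metric \<alpha>)"

definition plane_torus_dist :: "real \<Rightarrow> (real^2) \<times> (complex^'k::finite) \<Rightarrow> (real^2) \<times> (complex^'k) \<Rightarrow> real" where
  "plane_torus_dist \<alpha> = riemannian_dist plane_times_torus plane_torus_atlas (\<lambda>c. plane_torus_metric \<alpha>)"

lemma plane_torus_dist_eq:
  "plane_torus_dist \<alpha> p q = (if p \<in> plane_times_torus \<and> q \<in> plane_times_torus
     then INF \<gamma>\<in>plane_torus_paths p q. plane_torus_length \<alpha> \<gamma> else 0)"
proof -
  have "{curve_length plane_torus_atlas (\<lambda>c. plane_torus_metric \<alpha>) \<gamma> | \<gamma>.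
      piecewise_C1_path plane_times_torus plane_torus_atlas \<gamma> \<and> pathstart \<gamma> = p \<and> pathfinish \<gamma> = q} =
    plane_torus_length \<alpha> ` plane_torus_paths p q"
    unfolding plane_torus_paths_def plane_torus_length_def by blast
  then show ?thesis
    by (simp only: plane_torus_dist_def riemannian_dist_def)
qed

lemma plane_torus_paths_length_nonneg:
  "\<gamma> \<in> plane_torus_paths p q \<Longrightarrow> 0 \<le> plane_torus_length \<alpha> \<gamma>"
  unfolding plane_torus_paths_def plane_torus_length_def using path_integrable(2) by blast

lemma plane_torus_paths_endpoints:
  assumes "\<gamma> \<in> plane_torus_paths p q"
  shows "p \<in> plane_times_torus" "q \<in> plane_times_torus"
  using assms unfolding plane_torus_paths_def piecewise_C1_path_def
  by (auto dest: subsetD[OF _ pathstart_in_path_image] subsetD[OF _ pathfinish_in_path_image])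

lemma plane_torus_dist_le_length:
  assumes "\<gamma> \<in> plane_torus_paths p q"
  shows "plane_torus_dist \<alpha> p q \<le> plane_torus_length \<alpha> \<gamma>"
proof -
  have "bdd_below (plane_torus_length \<alpha> ` plane_torus_paths p q)"
    by (intro bdd_belowI[of _ 0]) (auto intro: plane_torus_paths_length_nonneg)
  then show ?thesis
    using plane_torus_paths_endpoints[OF assms] assms by (simp add: plane_torus_dist_eq cINF_lower)
qed

lemma plane_torus_dist_greatest:
  assumes "p \<in> plane_times_torus" "q \<in> plane_times_torus"
    and "\<And>\<gamma>. \<gamma> \<in> plane_torus_paths p q \<Longrightarrow> D \<le> plane_torus_length \<alpha> \<gamma>"
  shows "D \<le> plane_torus_dist \<alpha> p q"
  using assms by (simp add: plane_torus_dist_eq) (intro cINF_greatest plane_torus_paths_nonempty)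

lemma plane_torus_dist_lipschitz:
  fixes p q :: "(real^2) \<times> (complex^'k::finite)" and \<Phi> :: "(real^2) \<times> (complex^'k) \<Rightarrow> 'e::banach"
  assumes "\<And>p. (\<Phi> has_derivative \<Phi>' p) (at p)" "\<And>p w. norm (\<Phi>' p w) \<le> flat_speed \<alpha> p w"
    and "p \<in> plane_times_torus" "q \<in> plane_times_torus"
  shows "norm (\<Phi> q - \<Phi> p) \<le> plane_torus_dist \<alpha> p q"
proof (rule plane_torus_dist_greatest[OF assms(3,4)])
  fix \<gamma> assume "\<gamma> \<in> plane_torus_paths p q"
  then show "norm (\<Phi> q - \<Phi> p) \<le> plane_torus_length \<alpha> \<gamma>"
    using path_lipschitz(2)[OF _ assms(1,2), of \<gamma>]
    by (auto simp: plane_torus_paths_def plane_torus_length_def)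
qed

lemma norm_planar_le: "norm (planar z) \<le> norm z"
proof -
  have "planar z \<bullet> planar z \<le> z \<bullet> z"
    unfolding inner_vec_def[of z] sum_UNIV_Plus
    by (simp add: inner_vec_def planar_def sum_nonneg)
  then show ?thesis
    by (simp add: norm_le)
qed

text \<open>Makes the distance small when covering coordinates are close. The constant comes from ln
  (1 + t) \<le> t and only has to be bounded near \<open>x\<close>.\<close>

lemma plane_torus_dist_covering_le:
  assumes \<alpha>: "0 \<le> \<alpha>" "\<alpha> \<le> 1" and "norm (y - x) \<le> 1"
  shows "plane_torus_dist \<alpha> (plane_torus_covering x) (plane_torus_covering y) \<le> (2 + (norm x + 1)\<^sup>2) * norm (y - x)"
proof -
  have "ell (planar (x + t *\<^sub>R (y - x))) \<le> 2 + (norm x + 1)\<^sup>2" if t: "t \<in> {0..1}" for t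
  proof -
    let ?z = "planar (x + t *\<^sub>R (y - x))"
    have "norm (t *\<^sub>R (y - x)) \<le> 1 * 1"
      unfolding norm_scaleR using t assms(3) by (intro mult_mono) auto
    then have "norm ?z \<le> norm x + 1"
      using norm_planar_le[of "x + t *\<^sub>R (y - x)"] norm_triangle_ineq[of x "t *\<^sub>R (y - x)"] by linarith
    then have "?z \<bullet> ?z \<le> (norm x + 1)\<^sup>2"
      unfolding dot_square_norm by (intro power_mono) auto
    moreover have "ln (1 + ?z \<bullet> ?z) \<le> ?z \<bullet> ?z"
      by (rule ln_add_one_self_le_self) simp
    ultimately show ?thesis
      unfolding ell_def quad_def using inner_ge_zero[of ?z] by linarith
  qed
  from curve_length_segment_le[OF \<alpha> this]
  show ?thesis
    using plane_torus_dist_le_length[OF segment_in_paths[of x y], of \<alpha>]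
    by (simp add: plane_torus_length_def)
qed

section \<open>Symmetry and the triangle inequality\<close>

lemma plane_torus_paths_reverse:
  assumes "\<gamma> \<in> plane_torus_paths p q"
  shows "reversepath \<gamma> \<in> plane_torus_paths q p" "plane_torus_length \<alpha> (reversepath \<gamma>) = plane_torus_length \<alpha> \<gamma>"
proof -
  have \<gamma>: "piecewise_C1_path plane_times_torus plane_torus_atlas \<gamma>"
    using assms by (simp add: plane_torus_paths_def)
  show "reversepath \<gamma> \<in> plane_torus_paths q p"
    using assms piecewise_C1_path_reversepath[OF \<gamma>] by (simp add: plane_torus_paths_def)
  show "plane_torus_length \<alpha> (reversepath \<gamma>) = plane_torus_length \<alpha> \<gamma>"
    unfolding plane_torus_length_def
    by (rule curve_length_reversepath[OF \<gamma> path_integrable(1)[OF \<gamma>]]) (simp add: chart_at_plane_torus)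
qed

lemma plane_torus_paths_join:
  assumes "\<gamma> \<in> plane_torus_paths p q" "\<delta> \<in> plane_torus_paths q r"
  shows "\<gamma> +++ \<delta> \<in> plane_torus_paths p r"
    "plane_torus_length \<alpha> (\<gamma> +++ \<delta>) = plane_torus_length \<alpha> \<gamma> + plane_torus_length \<alpha> \<delta>"
proof -
  have \<gamma>: "piecewise_C1_path plane_times_torus plane_torus_atlas \<gamma>"
    and \<delta>: "piecewise_C1_path plane_times_torus plane_torus_atlas \<delta>"
    and join: "pathfinish \<gamma> = pathstart \<delta>"
    using assms by (simp_all add: plane_torus_paths_def)
  show "\<gamma> +++ \<delta> \<in> plane_torus_paths p r"
    using assms piecewise_C1_path_joinpaths[OF \<gamma> \<delta> join] by (simp add: plane_torus_paths_def)
  show "plane_torus_length \<alpha> (\<gamma> +++ \<delta>) = plane_torus_length \<alpha> \<gamma> + plane_torus_length \<alpha> \<delta>"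
    unfolding plane_torus_length_def
    by (rule curve_length_joinpaths[OF \<gamma> path_integrable(1)[OF \<gamma>] \<delta> path_integrable(1)[OF \<delta>] join])
      (simp add: chart_at_plane_torus)
qed

text \<open>The two infima are taken one at a time: over \<delta> with \<gamma> fixed, then over
  \<gamma>.\<close>

lemma plane_torus_dist_triangle:
  assumes "p \<in> plane_times_torus" "q \<in> plane_times_torus" "r \<in> plane_times_torus"
  shows "plane_torus_dist \<alpha> p r \<le> plane_torus_dist \<alpha> p q + plane_torus_dist \<alpha> q r"
proof -
  have *: "plane_torus_dist \<alpha> p r - plane_torus_length \<alpha> \<gamma> \<le> plane_torus_dist \<alpha> q r"
    if \<gamma>: "\<gamma> \<in> plane_torus_paths p q" for \<gamma>
  proof (rule plane_torus_dist_greatest[OF assms(2,3)])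
    fix \<delta> assume "\<delta> \<in> plane_torus_paths q r"
    from plane_torus_paths_join[OF \<gamma> this] plane_torus_dist_le_length[of "\<gamma> +++ \<delta>" p r \<alpha>]
    show "plane_torus_dist \<alpha> p r - plane_torus_length \<alpha> \<gamma> \<le> plane_torus_length \<alpha> \<delta>"
      by simp
  qed
  have "plane_torus_dist \<alpha> p r - plane_torus_dist \<alpha> q r \<le> plane_torus_dist \<alpha> p q"
  proof (rule plane_torus_dist_greatest[OF assms(1,2)])
    fix \<gamma> assume "\<gamma> \<in> plane_torus_paths p q"
    from *[OF this] show "plane_torus_dist \<alpha> p r - plane_torus_dist \<alpha> q r \<le> plane_torus_length \<alpha> \<gamma>"
      by simp
  qed
  then show ?thesis
    by simp
qed

lemma plane_torus_dist_commute:
  fixes p q :: "(real^2) \<times> (complex^'k::finite)"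
  shows "plane_torus_dist \<alpha> p q = plane_torus_dist \<alpha> q p"
proof -
  have le: "plane_torus_dist \<alpha> p q \<le> plane_torus_dist \<alpha> q p"
    if "p \<in> plane_times_torus" "q \<in> plane_times_torus" for p q :: "(real^2) \<times> (complex^'k)"
  proof (rule plane_torus_dist_greatest[OF that(2,1)])
    fix \<gamma> assume "\<gamma> \<in> plane_torus_paths q p"
    from plane_torus_paths_reverse[OF this] plane_torus_dist_le_length[of "reversepath \<gamma>" p q \<alpha>]
    show "plane_torus_dist \<alpha> p q \<le> plane_torus_length \<alpha> \<gamma>"
      by simp
  qed
  show ?thesis
  proof (cases "p \<in> plane_times_torus \<and> q \<in> plane_times_torus")
    case True
    then show ?thesis
      by (intro antisym le) simp_all
  next
    case False
    then show ?thesis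
      by (auto simp: plane_torus_dist_eq)
  qed
qed

section \<open>Completeness and decay\<close>

lemma flat_speed_ge_planar:
  "ell (fst p) powr \<alpha> * (norm (fst w) / sqrt (quad (fst p))) \<le> flat_speed \<alpha> p w"
proof -
  have "norm (fst w) / sqrt (quad (fst p)) = sqrt ((norm (fst w))\<^sup>2 / quad (fst p))"
    by (simp add: real_sqrt_divide)
  also have "\<dots> \<le> sqrt ((norm (fst w))\<^sup>2 / quad (fst p) + (norm (snd w))\<^sup>2)"
    by simp
  finally show ?thesis
    unfolding flat_speed_def by (intro mult_left_mono) simp_all
qed

lemma ell_powr_ge_1: "0 \<le> \<alpha> \<Longrightarrow> 1 \<le> ell y powr \<alpha>"
  using ell_ge_2[of y] by (intro ge_one_powr_ge_zero) simp_all

lemma norm_le_sqrt_quad: "norm y \<le> sqrt (quad y)"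
  by (rule real_le_rsqrt) (simp add: quad_def dot_square_norm)

definition radial :: "real \<Rightarrow> (real^2) \<times> (complex^'k::finite) \<Rightarrow> real" where
  "radial \<alpha> p = ell (fst p) powr (1 + \<alpha>) / (1 + \<alpha>)"

text \<open>Records the direction of the plane component, which \<open>radial\<close> cannot see.
  The differential of y/sqrt S is a sum of two terms, each bounded by the cigar norm; the factor 1/2
  makes the total at most that norm.\<close>

definition to_disc :: "(real^2) \<times> (complex^'k::finite) \<Rightarrow> real^2" where
  "to_disc p = (inverse (sqrt (quad (fst p))) / 2) *\<^sub>R fst p"

text \<open>\<open>radial\<close> is an antiderivative of \<open>l powr \<alpha>\<close> evaluated
  at \<open>ell\<close>, so its derivative reproduces the conformal factor. What remains is that
  \<open>ell\<close> is 1-Lipschitz for the cigar: |y|/S \<le> 1/sqrt S.\<close>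

lemma radial_lipschitz:
  assumes "0 \<le> \<alpha>" "p \<in> plane_times_torus" "q \<in> plane_times_torus"
  shows "\<bar>radial \<alpha> q - radial \<alpha> p\<bar> \<le> plane_torus_dist \<alpha> p q"
  unfolding real_norm_def[symmetric]
proof (rule plane_torus_dist_lipschitz[OF _ _ assms(2,3)])
  fix p w :: "(real^2) \<times> (complex^'a)"
  let ?D = "\<lambda>p w. ell (fst p) powr \<alpha> * ((fst p \<bullet> fst w) / quad (fst p))"
  have "((\<lambda>l. l powr (1 + \<alpha>) / (1 + \<alpha>)) has_real_derivative
      ((1 + \<alpha>) * ell (fst p) powr (1 + \<alpha> - 1)) / (1 + \<alpha>)) (at (ell (fst p)))"
    by (intro DERIV_cdivide has_real_derivative_powr ell_pos)
  moreover have "((\<lambda>p. ell (fst p)) has_derivative (\<lambda>w. (fst p \<bullet> fst w) / quad (fst p))) (at p)"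
    by (rule has_derivative_ell[OF has_derivative_fst[OF has_derivative_ident]])
  ultimately have "((\<lambda>p. ell (fst p) powr (1 + \<alpha>) / (1 + \<alpha>)) has_derivative
      (\<lambda>w. (fst p \<bullet> fst w) / quad (fst p) * (((1 + \<alpha>) * ell (fst p) powr (1 + \<alpha> - 1)) / (1 + \<alpha>)))) (at p)"
    by (rule DERIV_compose_FDERIV)
  then show "(radial \<alpha> has_derivative ?D p) (at p)"
    using assms(1) by (simp add: radial_def[abs_def] mult.commute)
  have "\<bar>fst p \<bullet> fst w\<bar> \<le> sqrt (quad (fst p)) * norm (fst w)"
    using Cauchy_Schwarz_ineq2[of "fst p" "fst w"] mult_right_mono[OF norm_le_sqrt_quad[of "fst p"] norm_ge_zero[of "fst w"]]
    by linarith
  then have "\<bar>fst p \<bullet> fst w\<bar> / quad (fst p) \<le> sqrt (quad (fst p)) * norm (fst w) / quad (fst p)"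
    by (intro divide_right_mono) (simp_all add: less_imp_le)
  also have "\<dots> = norm (fst w) / sqrt (quad (fst p))"
    by (simp add: field_simps abs_of_pos[OF quad_pos] flip: real_sqrt_mult)
  finally have "ell (fst p) powr \<alpha> * (\<bar>fst p \<bullet> fst w\<bar> / quad (fst p)) \<le>
      ell (fst p) powr \<alpha> * (norm (fst w) / sqrt (quad (fst p)))"
    by (rule mult_left_mono) simp
  moreover have "norm (?D p w) = ell (fst p) powr \<alpha> * (\<bar>fst p \<bullet> fst w\<bar> / quad (fst p))"
    by (simp add: abs_mult abs_of_pos[OF quad_pos])
  ultimately have "norm (?D p w) \<le> ell (fst p) powr \<alpha> * (norm (fst w) / sqrt (quad (fst p)))"
    by simp
  then show "norm (?D p w) \<le> flat_speed \<alpha> p w"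
    using flat_speed_ge_planar order_trans by blast
qed

lemma to_disc_lipschitz:
  assumes "0 \<le> \<alpha>" "p \<in> plane_times_torus" "q \<in> plane_times_torus"
  shows "norm (to_disc q - to_disc p) \<le> plane_torus_dist \<alpha> p q"
proof (rule plane_torus_dist_lipschitz[OF _ _ assms(2,3)])
  fix p w :: "(real^2) \<times> (complex^'a)"
  define r where "r p = sqrt (quad (fst p))" for p :: "(real^2) \<times> (complex^'a)"
  have r: "r p > 0" for p
    by (simp add: r_def)
  let ?D = "\<lambda>p w. (inverse (r p) / 2) *\<^sub>R fst w + (- (inverse (r p) * ((fst p \<bullet> fst w) / r p) * inverse (r p)) / 2) *\<^sub>R fst p"
  have "(r has_derivative (\<lambda>w. (fst p \<bullet> fst w) / r p)) (at p)"
    unfolding r_def[abs_def]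
    by (rule derivative_eq_intros refl | simp)+ (simp add: fun_eq_iff field_simps)
  from Deriv.has_derivative_inverse[OF _ this] r[of p]
  have "((\<lambda>p. inverse (r p)) has_derivative (\<lambda>w. - (inverse (r p) * ((fst p \<bullet> fst w) / r p) * inverse (r p)))) (at p)"
    by simp
  then have "((\<lambda>p. inverse (r p) / 2) has_derivative
      (\<lambda>w. - (inverse (r p) * ((fst p \<bullet> fst w) / r p) * inverse (r p)) / 2)) (at p)"
    by (rule bounded_linear.has_derivative[OF bounded_linear_divide])
  then show "(to_disc has_derivative ?D p) (at p)"
    unfolding to_disc_def[abs_def] r_def[symmetric]
    by (rule has_derivative_scaleR) (rule has_derivative_fst[OF has_derivative_ident])
  \<comment> \<open>The term from differentiating the normalising factor. Cauchy-Schwarz and |y|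
    \<le> \<open>r p\<close> cancel two powers of \<open>r p\<close>, leaving the same bound as for
    the other term.\<close>
  have "norm ((- (inverse (r p) * ((fst p \<bullet> fst w) / r p) * inverse (r p)) / 2) *\<^sub>R fst p) =
      \<bar>fst p \<bullet> fst w\<bar> * norm (fst p) / (2 * r p * r p * r p)"
    using r[of p] by (simp add: abs_mult field_simps)
  also have "\<dots> \<le> (r p * norm (fst w)) * r p / (2 * r p * r p * r p)"
    using r[of p] norm_le_sqrt_quad[of "fst p"]
      order_trans[OF Cauchy_Schwarz_ineq2[of "fst p" "fst w"] mult_right_mono[OF norm_le_sqrt_quad[of "fst p"] norm_ge_zero[of "fst w"]]]
    by (intro divide_right_mono mult_mono) (simp_all add: r_def less_imp_le)
  also have "\<dots> = norm (fst w) / r p / 2"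
    using r[of p] by simp
  finally have "norm (?D p w) \<le> norm (fst w) / r p / 2 + norm (fst w) / r p / 2"
    using r[of p] by (intro norm_triangle_le add_mono) (simp_all add: field_simps)
  also have "\<dots> = 1 * (norm (fst w) / r p)"
    by simp
  also have "\<dots> \<le> ell (fst p) powr \<alpha> * (norm (fst w) / r p)"
    using r[of p] by (intro mult_right_mono ell_powr_ge_1 assms(1)) simp
  also have "\<dots> \<le> flat_speed \<alpha> p w"
    unfolding r_def by (rule flat_speed_ge_planar)
  finally show "norm (?D p w) \<le> flat_speed \<alpha> p w" .
qed

lemma snd_lipschitz:
  assumes "0 \<le> \<alpha>" "p \<in> plane_times_torus" "q \<in> plane_times_torus"
  shows "norm (snd q - snd p) \<le> plane_torus_dist \<alpha> p q"
proof (rule plane_torus_dist_lipschitz[OF _ _ assms(2,3)])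
  fix p w :: "(real^2) \<times> (complex^'a)"
  show "(snd has_derivative snd) (at p)"
    by (auto intro!: derivative_eq_intros)
  have "1 * norm (snd w) \<le> flat_speed \<alpha> p w"
    unfolding flat_speed_def
    by (intro mult_mono ell_powr_ge_1 assms(1) real_le_rsqrt) (simp_all add: less_imp_le)
  then show "norm (snd w) \<le> flat_speed \<alpha> p w"
    by simp
qed

lemma quad_eq_ell: "quad y = exp (2 * (ell y - 2))"
  by (simp add: ell_def)

lemma ell_eq_radial: "0 \<le> \<alpha> \<Longrightarrow> ell (fst p) = ((1 + \<alpha>) * radial \<alpha> p) powr (1 / (1 + \<alpha>))"
  by (simp add: radial_def powr_powr abs_of_pos[OF ell_pos])

text \<open>The plane component is recovered from \<open>to_disc\<close> and \<open>radial\<close>. Since \<open>to_disc\<close> takes values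
  in a bounded disc, the coefficient has to come from \<open>radial\<close> to survive limits.\<close>

lemma fst_eq_to_disc: "fst p = (2 * sqrt (exp (2 * (ell (fst p) - 2)))) *\<^sub>R to_disc p"
  unfolding quad_eq_ell[symmetric] by (simp add: to_disc_def)

text \<open>Separation of points needs no local comparison of metrics: at distance 0 the three
  Lipschitz functions agree, and they are jointly injective.\<close>

lemma Metric_space_plane_torus:
  assumes \<alpha>: "0 \<le> \<alpha>" "\<alpha> \<le> 1"
  shows "Metric_space (plane_times_torus :: ((real^2) \<times> (complex^'k::finite)) set) (plane_torus_dist \<alpha>)"
proof
  fix p q r :: "(real^2) \<times> (complex^'k)"
  show "0 \<le> plane_torus_dist \<alpha> p q"
  proof (cases "p \<in> plane_times_torus \<and> q \<in> plane_times_torus")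
    case True
    then show ?thesis
      using order_trans[OF abs_ge_zero radial_lipschitz[OF \<alpha>(1)]] by blast
  qed (auto simp: plane_torus_dist_eq)
  show "plane_torus_dist \<alpha> p q = plane_torus_dist \<alpha> q p"
    by (rule plane_torus_dist_commute)
  assume pq: "p \<in> plane_times_torus" "q \<in> plane_times_torus"
  then show "plane_torus_dist \<alpha> p r \<le> plane_torus_dist \<alpha> p q + plane_torus_dist \<alpha> q r"
    if "r \<in> plane_times_torus"
    using that by (rule plane_torus_dist_triangle)
  show "plane_torus_dist \<alpha> p q = 0 \<longleftrightarrow> p = q"
  proof
    assume d: "plane_torus_dist \<alpha> p q = 0"
    have "snd p = snd q" "to_disc p = to_disc q" "radial \<alpha> p = radial \<alpha> q"
      using snd_lipschitz[OF \<alpha>(1) pq] to_disc_lipschitz[OF \<alpha>(1) pq] radial_lipschitz[OF \<alpha>(1) pq] d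
      by simp_all
    then show "p = q"
      using fst_eq_to_disc[of p] fst_eq_to_disc[of q] ell_eq_radial[OF \<alpha>(1), of p] ell_eq_radial[OF \<alpha>(1), of q]
      by (simp add: prod_eq_iff)
  next
    assume "p = q"
    obtain x where "plane_torus_covering x = p"
      using pq(1) by (rule plane_torus_covering_surj)
    then have "plane_torus_dist \<alpha> p p \<le> 0"
      using plane_torus_dist_covering_le[OF \<alpha>, of x x] by simp
    moreover have "0 \<le> plane_torus_dist \<alpha> p p"
      using radial_lipschitz[OF \<alpha>(1) pq(1) pq(1)] by simp
    ultimately show "plane_torus_dist \<alpha> p q = 0"
      using \<open>p = q\<close> by simp
  qed
qed

lemma complete_metric_plane_torus:
  assumes \<alpha>: "0 \<le> \<alpha>" "\<alpha> \<le> 1"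
  shows "complete_metric plane_times_torus plane_torus_atlas
    (\<lambda>c. plane_torus_metric \<alpha> :: real^(2 + 'k::finite) \<Rightarrow> _)"
proof -
  let ?M = "plane_times_torus :: ((real^2) \<times> (complex^'k)) set"
  interpret Metric_space ?M "plane_torus_dist \<alpha>"
    by (rule Metric_space_plane_torus[OF \<alpha>])
  have "\<exists>p. limitin mtopology \<sigma> p sequentially" if \<sigma>: "MCauchy \<sigma>" for \<sigma>
  proof -
    have M: "\<sigma> n \<in> ?M" for n
      using \<sigma> by (auto simp: MCauchy_def)
    \<comment> \<open>Every function into a Banach space that is 1-Lipschitz for the distance sends
      the Cauchy sequence to a convergent one. It is applied with three different target
      spaces.\<close>
    have conv: "convergent (\<lambda>n. \<Phi> (\<sigma> n))"
      if "\<And>p q. p \<in> ?M \<Longrightarrow> q \<in> ?M \<Longrightarrow> norm (\<Phi> q - \<Phi> p) \<le> plane_torus_dist \<alpha> p q"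
      for \<Phi> :: "(real^2) \<times> (complex^'k) \<Rightarrow> 'e::banach"
    proof (rule Cauchy_convergent, rule CauchyI)
      fix e :: real assume "0 < e"
      then obtain N where N: "\<forall>n n'. N \<le> n \<longrightarrow> N \<le> n' \<longrightarrow> plane_torus_dist \<alpha> (\<sigma> n) (\<sigma> n') < e"
        using \<sigma> unfolding MCauchy_def by blast
      have "norm (\<Phi> (\<sigma> m) - \<Phi> (\<sigma> n)) < e" if "N \<le> m" "N \<le> n" for m n
        using N that \<open>\<And>p q. p \<in> ?M \<Longrightarrow> q \<in> ?M \<Longrightarrow> norm (\<Phi> q - \<Phi> p) \<le> plane_torus_dist \<alpha> p q\<close>[OF M[of n] M[of m]]
          order_le_less_trans by blast
      then show "\<exists>N. \<forall>m\<ge>N. \<forall>n\<ge>N. norm (\<Phi> (\<sigma> m) - \<Phi> (\<sigma> n)) < e"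
        by blast
    qed
    obtain h where h: "(\<lambda>n. to_disc (\<sigma> n)) \<longlonglongrightarrow> h"
      using conv[OF to_disc_lipschitz[OF \<alpha>(1)]] by (auto simp: convergent_def)
    obtain z where z: "(\<lambda>n. snd (\<sigma> n)) \<longlonglongrightarrow> z"
      using conv[OF snd_lipschitz[OF \<alpha>(1)]] by (auto simp: convergent_def)
    obtain f where f: "(\<lambda>n. radial \<alpha> (\<sigma> n)) \<longlonglongrightarrow> f"
      using conv[of "radial \<alpha>"] radial_lipschitz[OF \<alpha>(1)] by (auto simp: convergent_def)
    have "1 \<le> (1 + \<alpha>) * radial \<alpha> p" for p :: "(real^2) \<times> (complex^'k)"
      using ell_powr_ge_1[of "1 + \<alpha>" "fst p"] \<alpha>(1) by (simp add: radial_def)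
    \<comment> \<open>Keeps the limit away from 0, so that \<open>powr\<close> is continuous
      there.\<close>
    then have "1 \<le> (1 + \<alpha>) * f"
      by (intro LIMSEQ_le_const[OF tendsto_mult_left[OF f]]) blast
    define l where "l = ((1 + \<alpha>) * f) powr (1 / (1 + \<alpha>))"
    have "(\<lambda>n. ell (fst (\<sigma> n))) \<longlonglongrightarrow> l"
      unfolding ell_eq_radial[OF \<alpha>(1)] l_def
      by (intro tendsto_powr tendsto_mult tendsto_const f) (use \<open>1 \<le> (1 + \<alpha>) * f\<close> in auto)
    then have "(\<lambda>n. (2 * sqrt (exp (2 * (ell (fst (\<sigma> n)) - 2)))) *\<^sub>R to_disc (\<sigma> n))
        \<longlonglongrightarrow> (2 * sqrt (exp (2 * (l - 2)))) *\<^sub>R h"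
      by (intro tendsto_intros h)
    then have "(\<lambda>n. fst (\<sigma> n)) \<longlonglongrightarrow> (2 * sqrt (exp (2 * (l - 2)))) *\<^sub>R h"
      by (simp only: fst_eq_to_disc[symmetric])
    then have "(\<lambda>n. (fst (\<sigma> n), snd (\<sigma> n))) \<longlonglongrightarrow> ((2 * sqrt (exp (2 * (l - 2)))) *\<^sub>R h, z)"
      using z by (rule tendsto_Pair)
    then obtain p where lim: "\<sigma> \<longlonglongrightarrow> p" and p: "snd p = z"
      by simp
    \<comment> \<open>The torus is closed in the ambient space, so the limit stays on the
      manifold.\<close>
    have "norm (z $ j) = 1" for j
    proof (rule LIMSEQ_unique)
      show "(\<lambda>n. norm (snd (\<sigma> n) $ j)) \<longlonglongrightarrow> norm (z $ j)"
        by (intro tendsto_norm tendsto_vec_nth z)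
      show "(\<lambda>n. norm (snd (\<sigma> n) $ j)) \<longlonglongrightarrow> 1"
        using M by (auto simp: plane_times_torus_def mem_Times_iff)
    qed
    then have pM: "p \<in> ?M"
      using p by (simp add: plane_times_torus_def mem_Times_iff)
    \<comment> \<open>One chart around the limit suffices: the sequence eventually enters it, its
      coordinates converge, and the segment bound turns this into convergence in the Riemannian
      distance.\<close>
    define c where "c = chart_at plane_torus_atlas p"
    have c: "c \<in> plane_torus_atlas" "p \<in> fst c"
      unfolding c_def by (rule chart_at_plane_torus[OF pM])+
    from c(1) smooth_atlas_plane_torus_atlas have open_c: "openin (top_of_set ?M) (fst c)"
      and "\<exists>h. homeomorphism (fst c) (chart_image c) (snd c) h"
      unfolding smooth_atlas_def by blast+
    then have cont: "continuous_on (fst c) (snd c)"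
      by (auto simp: homeomorphism_def)
    obtain U where "open U" "fst c = ?M \<inter> U"
      using open_c by (auto simp: openin_open)
    then have ev: "\<forall>\<^sub>F n in sequentially. \<sigma> n \<in> fst c"
      using topological_tendstoD[OF lim, of U] c(2) M by simp
    define x where "x = snd c p"
    have "(\<lambda>n. snd c (\<sigma> n)) \<longlonglongrightarrow> x"
      unfolding x_def by (rule continuous_on_tendsto_compose[OF cont lim c(2) ev])
    then have lim0: "(\<lambda>n. norm (snd c (\<sigma> n) - x)) \<longlonglongrightarrow> 0"
      by (simp add: LIM_zero tendsto_norm_zero)
    then have ev1: "\<forall>\<^sub>F n in sequentially. norm (snd c (\<sigma> n) - x) < 1"
      by (rule order_tendstoD(2)) simp
    have "\<forall>\<^sub>F n in sequentially. \<sigma> n \<in> ?M \<and> plane_torus_dist \<alpha> (\<sigma> n) p < e" if "0 < e" for e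
    proof -
      have "(\<lambda>n. (2 + (norm x + 1)\<^sup>2) * norm (snd c (\<sigma> n) - x)) \<longlonglongrightarrow> (2 + (norm x + 1)\<^sup>2) * 0"
        by (intro tendsto_intros lim0)
      then have "\<forall>\<^sub>F n in sequentially. (2 + (norm x + 1)\<^sup>2) * norm (snd c (\<sigma> n) - x) < e"
        using that by (intro order_tendstoD(2)) simp_all
      with ev ev1 show ?thesis
      proof eventually_elim
        case (elim n)
        have "plane_torus_covering x = p" "plane_torus_covering (snd c (\<sigma> n)) = \<sigma> n"
          unfolding x_def using elim(1) c by (auto intro: chart_covering)
        then have "plane_torus_dist \<alpha> p (\<sigma> n) < e"
          using plane_torus_dist_covering_le[OF \<alpha>, of "snd c (\<sigma> n)" x] elim(2,3) by simp
        then show ?case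
          using M plane_torus_dist_commute[of \<alpha> p "\<sigma> n"] by simp
      qed
    qed
    then show ?thesis
      using pM unfolding limitin_metric by blast
  qed
  then show ?thesis
    unfolding complete_metric_def plane_torus_dist_def[symmetric] mcomplete_def by blast
qed

lemma radial_pos: "0 \<le> \<alpha> \<Longrightarrow> 0 < radial \<alpha> p"
  by (simp add: radial_def)

text \<open>The curvature bound involves F(y), the claim d(x,y), and only d(x,y) \<ge> F(y) - F(x)
  is available. The strict gap between \<open>C\<close> and 1/(1 + \<alpha>) absorbs F(x) far
  away.\<close>

lemma at_most_quadratic_decay_plane_torus:
  fixes x :: "(real^2) \<times> (complex^'k::finite)"
  assumes \<alpha>: "\<alpha> * (real CARD('k) + 1) = 1" "0 < \<alpha>"
    and C: "0 < C" "C < 1 / (1 + \<alpha>)" and x: "x \<in> plane_times_torus"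
  shows "at_most_quadratic_decay C plane_times_torus plane_torus_atlas (\<lambda>c. plane_torus_metric \<alpha>) x"
proof -
  \<comment> \<open>The square root of the ratio of \<open>C\<close> to the critical constant 1/(1 +
    \<alpha>); it suffices to show that the distance is at least \<theta> F(y).\<close>
  define \<theta> where "\<theta> = sqrt (C * (1 + \<alpha>))"
  have "C * (1 + \<alpha>) < 1"
    using C \<alpha>(2) by (simp add: field_simps)
  then have \<theta>: "0 < \<theta>" "\<theta> < 1" "\<theta>\<^sup>2 = C * (1 + \<alpha>)"
    using C \<alpha>(2) by (simp_all add: \<theta>_def)
  \<comment> \<open>Chosen so that F(y) > \<open>D\<close> gives F(x) \<le> (1 - \<theta>) F(y),
    hence d \<ge> \<theta> F(y). If F(y) \<le> \<open>D\<close>, the distance exceeds \<theta> F(y)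
    because it is at least \<open>D\<close>.\<close>
  define D where "D = radial \<alpha> x / (1 - \<theta>)"
  have D: "D > 0"
    using \<theta> \<alpha>(2) by (simp add: D_def radial_pos)
  have "C / (plane_torus_dist \<alpha> x y)\<^sup>2 < scalar_curvature plane_torus_atlas (\<lambda>c. plane_torus_metric \<alpha>) y"
    if y: "y \<in> plane_times_torus" and dist: "D \<le> plane_torus_dist \<alpha> x y" for y
  proof -
    have pos: "0 < radial \<alpha> y"
      using \<alpha>(2) by (simp add: radial_pos)
    have "\<theta> * radial \<alpha> y \<le> plane_torus_dist \<alpha> x y"
    proof (cases "radial \<alpha> y \<le> D")
      case True
      have "\<theta> * radial \<alpha> y \<le> 1 * radial \<alpha> y"
        using \<theta>(2) pos by (intro mult_right_mono) auto
      with True dist show ?thesis by simp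
    next
      case False
      then have "radial \<alpha> x \<le> (1 - \<theta>) * radial \<alpha> y"
        using \<theta>(2) by (simp add: D_def field_simps)
      then show ?thesis
        using radial_lipschitz[OF less_imp_le[OF \<alpha>(2)] x y] by (simp add: algebra_simps)
    qed
    then have "(\<theta> * radial \<alpha> y)\<^sup>2 \<le> (plane_torus_dist \<alpha> x y)\<^sup>2"
      using \<theta>(1) pos by (intro power_mono) simp_all
    then have "C / (plane_torus_dist \<alpha> x y)\<^sup>2 \<le> C / (\<theta> * radial \<alpha> y)\<^sup>2"
      using C(1) \<theta>(1) pos D dist by (intro divide_left_mono) simp_all
    also have "\<dots> = (1 + \<alpha>) / ell (fst y) powr (2 + 2 * \<alpha>)"
    proof -
      define P where "P = ell (fst y) powr (2 + 2 * \<alpha>)"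
      have "P > 0"
        by (simp add: P_def)
      have "(ell (fst y) powr (1 + \<alpha>))\<^sup>2 = P"
        by (simp add: P_def power2_eq_square flip: powr_add)
      \<comment> \<open>By the choice of \<theta> the constant \<open>C\<close> now cancels, leaving
        exactly the lower bound for the scalar curvature.\<close>
      then have "(\<theta> * radial \<alpha> y)\<^sup>2 = C * (1 + \<alpha>) * (P / (1 + \<alpha>)\<^sup>2)"
        unfolding power_mult_distrib \<theta>(3) radial_def power_divide by simp
      also have "\<dots> = C * P / (1 + \<alpha>)"
        using \<alpha>(2) by (simp add: power2_eq_square)
      finally show ?thesis
        using C(1) \<alpha>(2) \<open>P > 0\<close> by (simp add: P_def)
    qed
    also have "\<dots> < scalar_curvature plane_torus_atlas (\<lambda>c. plane_torus_metric \<alpha>) y"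
      by (rule scalar_curvature_plane_torus_gt[OF \<alpha>(1) y])
    finally show ?thesis .
  qed
  then show ?thesis
    unfolding at_most_quadratic_decay_def plane_torus_dist_def[symmetric] using D by blast
qed

theorem proposition1p7:
  fixes n :: nat and C :: real
  assumes "n \<ge> 3"
    and "CARD('k::finite) = n - 2"
    and "0 < C" and "C < (real n - 1) / real n"
  shows "\<exists>g :: ((real^2) \<times> (complex^'k), 2 + 'k) metric_components.
           riemannian_metric plane_torus_atlas g \<and>
           complete_metric plane_times_torus plane_torus_atlas g \<and>
           positive_scalar_curvature plane_times_torus plane_torus_atlas g \<and>
           (\<forall>x\<in>plane_times_torus.
              at_most_quadratic_decay C plane_times_torus plane_torus_atlas g x)"
proof -
  \<comment> \<open>With n - 2 circle factors, k + 1 = n - 1. The critical constant 1/(1 + \<alpha>)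
    becomes (n - 1)/n, and the conformal factor grows like r^(2/n) because \<alpha>/(1 + \<alpha>) =
    1/n.\<close>
  define \<alpha> where "\<alpha> = 1 / (real n - 1)"
  have \<alpha>: "0 < \<alpha>" "\<alpha> \<le> 1" "\<alpha> * (real CARD('k) + 1) = 1"
    using assms(1) by (simp_all add: \<alpha>_def assms(2) of_nat_diff field_simps)
  have C: "C < 1 / (1 + \<alpha>)"
    using assms(1,4) by (simp add: \<alpha>_def field_simps)
  let ?g = "\<lambda>c :: ((real^2) \<times> (complex^'k), 2 + 'k) chart. plane_torus_metric \<alpha> :: real^(2 + 'k) \<Rightarrow> _"
  have "positive_scalar_curvature plane_times_torus plane_torus_atlas ?g"
    unfolding positive_scalar_curvature_def
  proof
    fix p :: "(real^2) \<times> (complex^'k)" assume "p \<in> plane_times_torus"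
    from scalar_curvature_plane_torus_gt[OF \<alpha>(3) this]
    show "0 < scalar_curvature plane_torus_atlas ?g p"
      by (rule order_less_trans[rotated]) (use \<alpha>(1) in simp)
  qed
  moreover have "complete_metric plane_times_torus plane_torus_atlas ?g"
    using \<alpha> by (intro complete_metric_plane_torus) simp_all
  ultimately show ?thesis
    using riemannian_metric_plane_torus at_most_quadratic_decay_plane_torus[OF \<alpha>(3,1) assms(3) C]
    by (intro exI[of _ ?g]) blast
qed

end
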